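(* Under the assumptions of the context, the asymptotic variance (second moment of the limiting distribution of $\sqrt n(\widehat\tau-\tau_0)$) of any regular estimator $\widehat\tau$ of $\tau_0$ based on $n$ one-sample observations is bounded below by $$V^{\mathrm{OS}}:=\mathbb E\big[\psi^{\mathrm{OS}}(X,O,\widetilde D,\widetilde Y;\mu_0,g_0,\tau_0)^2\big]=\mathbb E\Big[\frac{\sigma_0^2(1,X)}{g_0(1\mid X)}+\frac{\sigma_0^2(0,X)}{g_0(0\mid X)}+(\tau_0(X)-\tau_0)^2\Big].$$
   Context: One-sample scenario. There is a binary treatment $d\in\{0,1\}$ with potential outcomes $Y(1),Y(0)$ and covariates $X\in\mathcal X\subset\mathbb R^k$. We observe $n$ i.i.d. copies $(X_i,O_i,\widetilde D_i,\widetilde Y_i)$, where $O_i\in\{0,1\}$ is an observation indicator, $D_i\in\{0,1\}$ is a latent treatment indicator, $Y_i=\mathbb 1[D_i=1]Y_i(1)+\mathbb 1[D_i=0]Y_i(0)$, $(\widetilde D_i,\widetilde Y_i)=(D_i,Y_i)$ if $O_i=1$ and $=(\mathrm{NA},\mathrm{NA})$ (missing) if $O_i=0$. Let $p_0$ be the density of $X$, $\pi_0(o\mid x)=P(O=o\mid X=x)$, $e_0(d\mid x)=P(D=d\mid X=x,O=1)$, $g_0(d\mid x)=P(O=1,D=d\mid X=x)=\pi_0(1\mid x)e_0(d\mid x)$, $\mu_0(d,x)=\mathbb E[Y(d)\mid X=x]$, $\sigma_0^2(d,x)=\mathrm{Var}(Y(d)\mid X=x)$, $\tau_0(x)=\mu_0(1,x)-\mu_0(0,x)$,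 and $\tau_0=\mathbb E_{p_0}[\tau_0(X)]$ (evaluation density equal to $p_0$). The function $\psi^{\mathrm{OS}}=S^{\mathrm{OS}}-\tau_0$ with $S^{\mathrm{OS}}(X,O,\widetilde D,\widetilde Y;\mu,g)=\frac{\mathbb 1[O=1,\widetilde D=1](\widetilde Y-\mu(1,X))}{g(1\mid X)}-\frac{\mathbb 1[O=1,\widetilde D=0](\widetilde Y-\mu(0,X))}{g(0\mid X)}+\mu(1,X)-\mu(0,X)$. Assumptions: constants $0<\underline C<\overline C<\infty$ with $|\mu_0(d,x)|<\overline C$, $\underline C<\sigma_0^2(d,x)<\overline C$; $(Y(1),Y(0))\perp D\mid X$ and $(Y(1),Y(0))\perp O\mid X$; there is $\epsilon\in(0,1/2)$ with $\epsilon<g_0(d\mid X)\le1-\epsilon$ a.s. for $d\in\{0,1\}$.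
   Formalization: The two separate conditions that (Y(1),Y(0)) is independent of D given X and of O given X are replaced by independence of (Y(1),Y(0)) from the pair (O,D) jointly given X; with the separate conditions alone the stated identity for V^OS can fail. *)

theory Defs
  imports "HOL-Probability.Probability"
begin

text \<open>Observation (X, O, Dtilde, Ytilde). The missing value NA of (Dtilde, Ytilde)
  when O = False is encoded by the fixed dummy value (False, 0).\<close>
type_synonym 'x obs = "'x \<times> bool \<times> bool \<times> real"

definition Mobs :: "('x::euclidean_space) obs measure" where
  "Mobs = borel \<Otimes>\<^sub>M (count_space UNIV \<Otimes>\<^sub>M (count_space UNIV \<Otimes>\<^sub>M borel))"

text \<open>Full data (X, O, D, Y(1), Y(0)).\<close>
definition Mfull :: "('x::euclidean_space \<times> bool \<times> bool \<times> real \<times> real) measure" where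
  "Mfull = borel \<Otimes>\<^sub>M (count_space UNIV \<Otimes>\<^sub>M (count_space UNIV \<Otimes>\<^sub>M (borel \<Otimes>\<^sub>M borel)))"

text \<open>A data generating process: law of X, pi(1|x) = P(O=1|X=x), e(1|x) = P(D=1|X=x,O=1),
  and conditional law of (Y(1),Y(0)) given X=x.\<close>
record 'x dgp =
  px  :: "'x measure"
  pi1 :: "'x \<Rightarrow> real"
  e1  :: "'x \<Rightarrow> real"
  ky  :: "'x \<Rightarrow> (real \<times> real) measure"

definition gprop :: "'x dgp \<Rightarrow> bool \<Rightarrow> 'x \<Rightarrow> real" where
  "gprop S d x = pi1 S x * (if d then e1 S x else 1 - e1 S x)"

definition mu :: "'x dgp \<Rightarrow> bool \<Rightarrow> 'x \<Rightarrow> real" where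
  "mu S d x = (\<integral>p. (if d then fst p else snd p) \<partial>(ky S x))"

definition sig2 :: "'x dgp \<Rightarrow> bool \<Rightarrow> 'x \<Rightarrow> real" where
  "sig2 S d x = (\<integral>p. ((if d then fst p else snd p) - mu S d x)\<^sup>2 \<partial>(ky S x))"

definition cate :: "'x dgp \<Rightarrow> 'x \<Rightarrow> real" where
  "cate S x = mu S True x - mu S False x"

definition tau :: "'x dgp \<Rightarrow> real" where
  "tau S = (\<integral>x. cate S x \<partial>(px S))"

definition full_law :: "'x::euclidean_space dgp \<Rightarrow> ('x \<times> bool \<times> bool \<times> real \<times> real) measure" where
  "full_law S = bind (px S) (\<lambda>x. distr
      (measure_pmf (pair_pmf (bernoulli_pmf (pi1 S x)) (bernoulli_pmf (e1 S x))) \<Otimes>\<^sub>M ky S x)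
      Mfull (\<lambda>((ob, d), (y1, y0)). (x, ob, d, y1, y0)))"

definition obs_map :: "'x \<times> bool \<times> bool \<times> real \<times> real \<Rightarrow> 'x obs" where
  "obs_map w = (case w of (x, ob, d, y1, y0) \<Rightarrow>
      (x, ob, if ob then d else False, if ob then (if d then y1 else y0) else 0))"

definition obs_law :: "'x::euclidean_space dgp \<Rightarrow> 'x obs measure" where
  "obs_law S = distr (full_law S) Mobs obs_map"

definition in_model :: "real \<Rightarrow> real \<Rightarrow> real \<Rightarrow> 'x::euclidean_space dgp \<Rightarrow> bool" where
  "in_model Clo Chi eps S \<longleftrightarrow>
     prob_space (px S) \<and> sets (px S) = sets borel \<and> absolutely_continuous lborel (px S) \<and>
     pi1 S \<in> borel_measurable borel \<and> e1 S \<in> borel_measurable borel \<and>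
     (\<forall>x. 0 \<le> pi1 S x \<and> pi1 S x \<le> 1 \<and> 0 \<le> e1 S x \<and> e1 S x \<le> 1) \<and>
     ky S \<in> borel \<rightarrow>\<^sub>M prob_algebra borel \<and>
     (\<forall>x. integrable (ky S x) (\<lambda>p. (fst p)\<^sup>2) \<and> integrable (ky S x) (\<lambda>p. (snd p)\<^sup>2)) \<and>
     (\<forall>d x. \<bar>mu S d x\<bar> < Chi \<and> Clo < sig2 S d x \<and> sig2 S d x < Chi) \<and>
     (AE x in px S. \<forall>d. eps < gprop S d x \<and> gprop S d x \<le> 1 - eps)"

definition S_OS :: "'x dgp \<Rightarrow> 'x obs \<Rightarrow> real" where
  "S_OS S z = (case z of (x, ob, d, y) \<Rightarrow>
      (if ob \<and> d then (y - mu S True x) / gprop S True x else 0)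
    - (if ob \<and> \<not> d then (y - mu S False x) / gprop S False x else 0)
    + mu S True x - mu S False x)"

definition psi_OS :: "'x dgp \<Rightarrow> 'x obs \<Rightarrow> real" where
  "psi_OS S z = S_OS S z - tau S"

definition V_OS :: "'x::euclidean_space dgp \<Rightarrow> real" where
  "V_OS S = (\<integral>z. (psi_OS S z)\<^sup>2 \<partial>(obs_law S))"

definition qmd_path :: "'a measure \<Rightarrow> (real \<Rightarrow> 'a measure) \<Rightarrow> bool" where
  "qmd_path M Q \<longleftrightarrow> (\<exists>\<nu> q s \<delta>. sigma_finite_measure \<nu> \<and> sets \<nu> = sets M \<and> \<delta> > 0 \<and>
     s \<in> borel_measurable M \<and>
     (\<forall>t. \<bar>t\<bar> < \<delta> \<longrightarrow> q t \<in> borel_measurable M \<and> (\<forall>z. 0 \<le> q t z) \<and>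
          Q t = density \<nu> (\<lambda>z. ennreal (q t z))) \<and>
     ((\<lambda>t. \<integral>\<^sup>+z. ennreal ((sqrt (q t z) - sqrt (q 0 z) - t / 2 * s z * sqrt (q 0 z))\<^sup>2 / t\<^sup>2) \<partial>\<nu>)
        \<longlongrightarrow> 0) (at 0))"

definition regular_estimator :: "real \<Rightarrow> real \<Rightarrow> real \<Rightarrow> 'x::euclidean_space dgp \<Rightarrow>
    (nat \<Rightarrow> (nat \<Rightarrow> 'x obs) \<Rightarrow> real) \<Rightarrow> real measure \<Rightarrow> bool" where
  "regular_estimator Clo Chi eps S0 T L \<longleftrightarrow>
     real_distribution L \<and>
     (\<forall>n. T n \<in> borel_measurable (PiM {..<n} (\<lambda>_. Mobs))) \<and>
     (\<forall>F :: real \<Rightarrow> 'x dgp. F 0 = S0 \<and> (\<exists>\<delta>>0. \<forall>t. \<bar>t\<bar> < \<delta> \<longrightarrow> in_model Clo Chi eps (F t)) \<and>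
        qmd_path Mobs (\<lambda>t. obs_law (F t)) \<longrightarrow>
        weak_conv_m (\<lambda>n. distr (PiM {..<n} (\<lambda>_. obs_law (F (1 / sqrt (real n))))) borel
                        (\<lambda>\<omega>. sqrt (real n) * (T n \<omega> - tau (F (1 / sqrt (real n)))))) L)"

end

(*
  Comparing the law of the data at t = 1/sqrt n along a path with the law at t = 0 by the
  Hammersley-Chapman-Robbins (chi-square) inequality makes local asymptotic normality superfluous.
  Along a path whose observed density is exactly 1 + t s, the n-fold likelihood ratio has second
  moment at most exp (E s^2), and if tau moves by exactly t k along the path, regularity says that the
  limit law L shifts by k between the two experiments. Applied to a clamped identity, the inequality
  gives k^2 <= (exp (E s^2) - 1) * (second moment of L), and replacing s by c s with c -> 0 gives
  k^2 <= E s^2 * (second moment of L).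

  The model bounds are strict but not uniform, so the efficient influence function is not itself an
  admissible direction. Its outcome part is therefore truncated, recentred, and switched off at the
  covariates whose moments are within 1/(k+1) of the bounds. For the k-th truncation the derivative
  of tau is at least E s^2, hence at most the second moment of L, and it converges to V_OS.
*)
theory Submission
  imports Defs
begin

section \<open>An information bound for regular estimators\<close>

text \<open>Both the observed law and \<open>tau\<close> depend on the potential outcomes only
  through their two marginals. The tilt therefore reweights each arm separately and couples the
  results independently; at t = 0 it can differ from the given process although the observed laws
  agree, so paths have to be patched there. The propensities stay fixed along every path, which
  loses nothing: the efficient influence function is a covariate score plus outcome scores of
  conditional mean zero.

  Staying in the model is the obstacle. The moment bounds are imposed at every covariate, and even a
  bounded outcome score can push a moment across its bound where the slack is arbitrarily small.
  Reweighting covariates moves no conditional moment, and the conditional effect is already bounded,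
  so the covariate score is used as it is.

  Recentring a truncated outcome score only lowers its variance, so its information J and the slope
  kappa of \<open>tau\<close> satisfy J <= kappa. With M the second moment of L, kappa^2 <= J M <=
  kappa M, and kappa cancels.\<close>

lemma Cauchy_Schwarz_lebesgue_integral:
  fixes f g :: "'a \<Rightarrow> real"
  assumes [simp]: "integrable M (\<lambda>x. (f x)\<^sup>2)" "integrable M (\<lambda>x. (g x)\<^sup>2)"
    and [simp]: "integrable M (\<lambda>x. f x * g x)"
  shows "(\<integral>x. f x * g x \<partial>M)\<^sup>2 \<le> (\<integral>x. (f x)\<^sup>2 \<partial>M) * (\<integral>x. (g x)\<^sup>2 \<partial>M)"
proof -
  define F G P where "F = (\<integral>x. (f x)\<^sup>2 \<partial>M)" and "G = (\<integral>x. (g x)\<^sup>2 \<partial>M)"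
    and "P = (\<integral>x. f x * g x \<partial>M)"
  have q: "0 \<le> F - 2 * c * P + c\<^sup>2 * G" for c
  proof -
    have "0 \<le> (\<integral>x. (f x - c * g x)\<^sup>2 \<partial>M)"
      by (rule integral_nonneg_AE) simp
    also have "\<dots> = (\<integral>x. (f x)\<^sup>2 - 2 * c * (f x * g x) + c\<^sup>2 * (g x)\<^sup>2 \<partial>M)"
      by (rule Bochner_Integration.integral_cong) (auto simp: power2_eq_square algebra_simps)
    also have "\<dots> = F - 2 * c * P + c\<^sup>2 * G"
      by (simp add: F_def G_def P_def)
    finally show ?thesis .
  qed
  have "0 \<le> G" by (simp add: G_def)
  show ?thesis
  proof (cases "G = 0")
    case True
    \<comment> \<open>With G = 0 the quadratic is affine in c, and at c = (F + 1) / (2 P) it would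
      equal -1.\<close>
    have "P = 0"
      using q[of "(F + 1) / (2 * P)"] True by (cases "P = 0") (auto simp: field_simps)
    then show ?thesis by (simp add: True F_def[symmetric] G_def[symmetric] P_def[symmetric])
  next
    case False
    then have "0 < G" using \<open>0 \<le> G\<close> by simp
    then have "P\<^sup>2 \<le> F * G"
      using q[of "P / G"] by (simp add: field_simps power2_eq_square)
    then show ?thesis by (simp add: F_def G_def P_def)
  qed
qed

text \<open>Both sides agree on finite boxes, where Tonelli factors the integral, and boxes
  determine the product measure. With \<open>f\<close> the density of one observation, the product
  on the right is the n-fold likelihood ratio.\<close>

lemma density_PiM:
  assumes M: "prob_space M" and D: "prob_space (density M f)" and I: "finite I"
    and f [measurable]: "f \<in> borel_measurable M"
  shows "PiM I (\<lambda>_. density M f) = density (PiM I (\<lambda>_. M)) (\<lambda>\<omega>. \<Prod>i\<in>I. f (\<omega> i))"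
proof -
  interpret M: prob_space M by fact
  interpret D: prob_space "density M f" by fact
  interpret M: product_sigma_finite "\<lambda>_. M"
    by standard
  interpret D: product_sigma_finite "\<lambda>_. density M f"
    by standard
  show ?thesis
  proof (rule D.PiM_eqI[OF I, symmetric])
    show "sets (density (PiM I (\<lambda>_. M)) (\<lambda>\<omega>. \<Prod>i\<in>I. f (\<omega> i))) = sets (PiM I (\<lambda>_. density M f))"
      unfolding sets_density by (rule sets_PiM_cong) auto
    fix A assume A: "A i \<in> sets (density M f)" if "i \<in> I" for i
    then have A': "A i \<in> sets M" if "i \<in> I" for i using that by simp
    then have E: "Pi\<^sub>E I A \<in> sets (PiM I (\<lambda>_. M))"
      by (intro sets_PiM_I_finite I) auto
    have "emeasure (density (PiM I (\<lambda>_. M)) (\<lambda>\<omega>. \<Prod>i\<in>I. f (\<omega> i))) (Pi\<^sub>E I A)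
        = (\<integral>\<^sup>+\<omega>. (\<Prod>i\<in>I. f (\<omega> i)) * indicator (Pi\<^sub>E I A) \<omega> \<partial>PiM I (\<lambda>_. M))"
      by (rule emeasure_density[OF _ E]) measurable
    also have "\<dots> = (\<integral>\<^sup>+\<omega>. (\<Prod>i\<in>I. f (\<omega> i) * indicator (A i) (\<omega> i)) \<partial>PiM I (\<lambda>_. M))"
    proof (rule nn_integral_cong)
      fix \<omega> assume w: "\<omega> \<in> space (PiM I (\<lambda>_. M))"
      have "indicator (Pi\<^sub>E I A) \<omega> = (\<Prod>i\<in>I. indicator (A i) (\<omega> i) :: ennreal)"
      proof (cases "\<omega> \<in> Pi\<^sub>E I A")
        case True then show ?thesis by (auto simp: indicator_def PiE_iff intro!: prod.neutral[symmetric])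
      next
        case False
        then obtain i where "i \<in> I" "\<omega> i \<notin> A i" using w by (auto simp: space_PiM PiE_iff)
        then have "(\<Prod>i\<in>I. indicator (A i) (\<omega> i) :: ennreal) = 0"
          using I by (auto intro!: prod_zero bexI[of _ i])
        with False show ?thesis by simp
      qed
      then show "(\<Prod>i\<in>I. f (\<omega> i)) * indicator (Pi\<^sub>E I A) \<omega> = (\<Prod>i\<in>I. f (\<omega> i) * indicator (A i) (\<omega> i))"
        by (simp add: prod.distrib)
    qed
    also have "\<dots> = (\<Prod>i\<in>I. \<integral>\<^sup>+x. f x * indicator (A i) x \<partial>M)"
      using A' by (intro M.product_nn_integral_prod I) auto
    also have "\<dots> = (\<Prod>i\<in>I. emeasure (density M f) (A i))"
      using A' by (intro prod.cong refl) (simp add: emeasure_density)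
    finally show "emeasure (density (PiM I (\<lambda>_. M)) (\<lambda>\<omega>. \<Prod>i\<in>I. f (\<omega> i))) (Pi\<^sub>E I A) = \<dots>" .
  qed
qed

text \<open>The expectations differ by the integral of (\<Lambda> - 1) h, and Cauchy-Schwarz
  separates the chi-square distance from \<open>h\<close>. The second moment of \<open>h\<close>
  stands where the sharp form has a variance; this matches the target, the second moment of the
  limit law.\<close>

lemma Hammersley_Chapman_Robbins:
  assumes M: "prob_space M"
    and \<Lambda> [measurable]: "\<Lambda> \<in> borel_measurable M" and nn: "AE x in M. 0 \<le> \<Lambda> x"
    and \<Lambda>1: "(\<integral>x. \<Lambda> x \<partial>M) = 1" and \<Lambda>2: "integrable M (\<lambda>x. (\<Lambda> x)\<^sup>2)"
    and h [measurable]: "h \<in> borel_measurable M" and hB: "\<And>x. \<bar>h x\<bar> \<le> B"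
  shows "((\<integral>x. h x \<partial>density M (\<lambda>x. ennreal (\<Lambda> x))) - (\<integral>x. h x \<partial>M))\<^sup>2
           \<le> ((\<integral>x. (\<Lambda> x)\<^sup>2 \<partial>M) - 1) * (\<integral>x. (h x)\<^sup>2 \<partial>M)"
proof -
  interpret prob_space M by fact
  have i\<Lambda> [simp]: "integrable M \<Lambda>"
    using square_integrable_imp_integrable[OF \<Lambda> \<Lambda>2] .
  have ih [simp]: "integrable M h"
    using hB by (intro integrable_const_bound[of _ B]) auto
  have ih2 [simp]: "integrable M (\<lambda>x. (h x)\<^sup>2)"
  proof (rule integrable_const_bound[of _ "B\<^sup>2"])
    show "AE x in M. norm ((h x)\<^sup>2) \<le> B\<^sup>2" using hB abs_le_square_iff order_trans[OF abs_ge_zero hB]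
      by (auto intro!: power2_le_iff_abs_le[THEN iffD2])
  qed simp
  have i\<Lambda>h [simp]: "integrable M (\<lambda>x. \<Lambda> x * h x)"
    by (rule Bochner_Integration.integrable_bound[of _ "\<lambda>x. B * \<Lambda> x"])
       (use nn hB in \<open>auto simp: abs_mult mult.commute[of "\<bar>B\<bar>"]
          intro!: mult_left_mono order_trans[OF hB abs_ge_self] elim!: eventually_mono\<close>)
  have i3: "integrable M (\<lambda>x. (\<Lambda> x - 1)\<^sup>2)"
    using \<Lambda>2 by (simp add: power2_diff)
  have "(\<integral>x. h x \<partial>density M (\<lambda>x. ennreal (\<Lambda> x))) - (\<integral>x. h x \<partial>M)
      = (\<integral>x. \<Lambda> x * h x \<partial>M) - (\<integral>x. h x \<partial>M)"
    using nn by (subst integral_real_density) auto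
  also have "\<dots> = (\<integral>x. (\<Lambda> x - 1) * h x \<partial>M)"
    by (simp add: left_diff_distrib)
  also have "\<dots>\<^sup>2 \<le> (\<integral>x. (\<Lambda> x - 1)\<^sup>2 \<partial>M) * (\<integral>x. (h x)\<^sup>2 \<partial>M)"
    by (rule Cauchy_Schwarz_lebesgue_integral) (simp_all add: i3 left_diff_distrib)
  also have "(\<integral>x. (\<Lambda> x - 1)\<^sup>2 \<partial>M) = (\<integral>x. (\<Lambda> x)\<^sup>2 \<partial>M) - 1"
    using \<Lambda>2 by (simp add: power2_diff \<Lambda>1 prob_space)
  finally show ?thesis .
qed

lemma prob_space_linear_tilt:
  assumes M: "prob_space M" and s [measurable]: "s \<in> borel_measurable M"
    and i: "integrable M s" and mean: "(\<integral>x. s x \<partial>M) = (0::real)"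
    and nn: "\<And>x. 0 \<le> 1 + t * s x"
  shows "prob_space (density M (\<lambda>x. ennreal (1 + t * s x)))"
proof
  interpret prob_space M by fact
  have "emeasure (density M (\<lambda>x. ennreal (1 + t * s x))) (space M) = (\<integral>\<^sup>+x. ennreal (1 + t * s x) \<partial>M)"
    by (subst emeasure_density) (auto intro!: nn_integral_cong)
  also have "\<dots> = ennreal (\<integral>x. 1 + t * s x \<partial>M)"
    using i nn by (intro nn_integral_eq_integral) auto
  also have "\<dots> = 1" using i mean by (simp add: prob_space)
  finally show "emeasure (density M (\<lambda>x. ennreal (1 + t * s x)))
    (space (density M (\<lambda>x. ennreal (1 + t * s x)))) = 1" by simp
qed

text \<open>Let J be the second moment of \<open>s\<close>. The squared likelihood ratio factors
  under the product measure; as \<open>s\<close> has mean 0, each factor contributes 1 + t^2 J,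
  which is at most exp (t^2 J). At t = 1 / sqrt n the exponent no longer depends on n. The condition
  on \<open>t\<close> keeps the density nonnegative.\<close>

lemma PiM_tilt_bound:
  fixes s :: "'a \<Rightarrow> real" and n :: nat and t :: real
  assumes M: "prob_space M" and s [measurable]: "s \<in> borel_measurable M"
    and sB: "\<And>x. \<bar>s x\<bar> \<le> B" and mean: "(\<integral>x. s x \<partial>M) = 0"
    and t: "\<bar>t\<bar> * B \<le> 1"
    and h [measurable]: "h \<in> borel_measurable (PiM {..<n} (\<lambda>_. M))" and hB: "\<And>x. \<bar>h x\<bar> \<le> H"
  shows "((\<integral>x. h x \<partial>PiM {..<n} (\<lambda>_. density M (\<lambda>x. ennreal (1 + t * s x))))
            - (\<integral>x. h x \<partial>PiM {..<n} (\<lambda>_. M)))\<^sup>2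
         \<le> (exp (n * t\<^sup>2 * (\<integral>x. (s x)\<^sup>2 \<partial>M)) - 1) * (\<integral>x. (h x)\<^sup>2 \<partial>PiM {..<n} (\<lambda>_. M))"
proof -
  interpret prob_space M by fact
  interpret P: product_prob_space "\<lambda>_. M" "{..<n}" by standard
  define \<Lambda> where "\<Lambda> \<omega> = (\<Prod>i<n. 1 + t * s (\<omega> i))" for \<omega>
  define J where "J = (\<integral>x. (s x)\<^sup>2 \<partial>M)"
  have nn: "0 \<le> 1 + t * s x" for x
  proof -
    have "\<bar>t * s x\<bar> \<le> \<bar>t\<bar> * B" by (simp add: abs_mult mult_left_mono sB)
    then show ?thesis using t by linarith
  qed
  have [simp]: "integrable M s"
    using sB by (intro integrable_const_bound[of _ B]) auto
  have [simp]: "integrable M (\<lambda>x. (s x)\<^sup>2)"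
  proof (rule integrable_const_bound[of _ "B\<^sup>2"])
    show "AE x in M. norm ((s x)\<^sup>2) \<le> B\<^sup>2" using sB order_trans[OF abs_ge_zero sB]
      by (auto intro!: power2_le_iff_abs_le[THEN iffD2])
  qed simp
  have D: "prob_space (density M (\<lambda>x. ennreal (1 + t * s x)))"
    by (rule prob_space_linear_tilt) (auto simp: M mean nn)
  have eq: "PiM {..<n} (\<lambda>_. density M (\<lambda>x. ennreal (1 + t * s x)))
      = density (PiM {..<n} (\<lambda>_. M)) (\<lambda>\<omega>. ennreal (\<Lambda> \<omega>))"
    unfolding \<Lambda>_def by (subst density_PiM[OF M D finite_lessThan]) (auto simp: prod_ennreal nn)
  have \<Lambda>_meas [measurable]: "\<Lambda> \<in> borel_measurable (PiM {..<n} (\<lambda>_. M))"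
    unfolding \<Lambda>_def by measurable
  have \<Lambda>1: "(\<integral>\<omega>. \<Lambda> \<omega> \<partial>PiM {..<n} (\<lambda>_. M)) = 1"
    unfolding \<Lambda>_def by (subst P.product_integral_prod) (auto simp: mean prob_space)
  have sq: "(1 + t * s x)\<^sup>2 = 1 + 2 * t * s x + t\<^sup>2 * (s x)\<^sup>2" for x
    by (simp add: power2_eq_square algebra_simps)
  have \<Lambda>sq: "(\<Lambda> \<omega>)\<^sup>2 = (\<Prod>i<n. (1 + t * s (\<omega> i))\<^sup>2)" for \<omega>
    by (simp add: \<Lambda>_def prod_power_distrib)
  have \<Lambda>2i: "integrable (PiM {..<n} (\<lambda>_. M)) (\<lambda>\<omega>. (\<Lambda> \<omega>)\<^sup>2)"
    unfolding \<Lambda>sq by (rule P.product_integrable_prod) (auto simp: sq)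
  have \<Lambda>2: "(\<integral>\<omega>. (\<Lambda> \<omega>)\<^sup>2 \<partial>PiM {..<n} (\<lambda>_. M)) = (1 + t\<^sup>2 * J) ^ n"
    unfolding \<Lambda>sq by (subst P.product_integral_prod) (auto simp: sq mean prob_space J_def)
  have J0: "0 \<le> J" by (simp add: J_def)
  have "(1 + t\<^sup>2 * J) ^ n \<le> exp (t\<^sup>2 * J) ^ n"
    using J0 by (intro power_mono) auto
  also have "\<dots> = exp (n * t\<^sup>2 * J)" by (simp add: exp_of_nat_mult[symmetric] mult.assoc)
  finally have le: "(1 + t\<^sup>2 * J) ^ n \<le> exp (n * t\<^sup>2 * J)" .
  have "((\<integral>x. h x \<partial>PiM {..<n} (\<lambda>_. density M (\<lambda>x. ennreal (1 + t * s x))))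
            - (\<integral>x. h x \<partial>PiM {..<n} (\<lambda>_. M)))\<^sup>2
      \<le> ((\<integral>\<omega>. (\<Lambda> \<omega>)\<^sup>2 \<partial>PiM {..<n} (\<lambda>_. M)) - 1) * (\<integral>x. (h x)\<^sup>2 \<partial>PiM {..<n} (\<lambda>_. M))"
    unfolding eq
    by (rule Hammersley_Chapman_Robbins[OF P.prob_space_axioms \<Lambda>_meas _ \<Lambda>1 \<Lambda>2i h hB])
       (auto simp: \<Lambda>_def intro!: prod_nonneg nn)
  also have "\<dots> \<le> (exp (n * t\<^sup>2 * J) - 1) * (\<integral>x. (h x)\<^sup>2 \<partial>PiM {..<n} (\<lambda>_. M))"
    unfolding \<Lambda>2 using le by (intro mult_right_mono) auto
  finally show ?thesis unfolding J_def .
qed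

text \<open>Test functions are the clamped identity; letting the clamping level go to infinity turns the
  difference of expectations into the shift \<open>\<kappa>\<close>.\<close>

lemma clamp_shift_tendsto:
  fixes L :: "real measure"
  assumes "real_distribution L"
  shows "(\<lambda>k. \<integral>x. max (- real k) (min (real k) (x + \<kappa>)) - max (- real k) (min (real k) x) \<partial>L)
           \<longlonglongrightarrow> \<kappa>"
proof -
  interpret real_distribution L by fact
  have "(\<lambda>k. \<integral>x. max (- real k) (min (real k) (x + \<kappa>)) - max (- real k) (min (real k) x) \<partial>L)
           \<longlonglongrightarrow> (\<integral>x. \<kappa> \<partial>L)"
  \<comment> \<open>Clamping is 1-Lipschitz, hence the dominating constant |\<kappa>|; once k
    reaches |x| + |\<kappa>|, neither clamp is active.\<close>
  proof (rule integral_dominated_convergence[where w="\<lambda>_. \<bar>\<kappa>\<bar>"])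
    show "AE x in L. (\<lambda>k. max (- real k) (min (real k) (x + \<kappa>)) - max (- real k) (min (real k) x)) \<longlonglongrightarrow> \<kappa>"
    proof (rule AE_I2)
      fix x
      obtain N :: nat where N: "\<bar>x\<bar> + \<bar>\<kappa>\<bar> \<le> N" using real_arch_simple by blast
      have "\<forall>\<^sub>F k in sequentially. max (- real k) (min (real k) (x + \<kappa>)) - max (- real k) (min (real k) x) = \<kappa>"
        using eventually_ge_at_top[of N]
      proof eventually_elim
        case (elim k) then have "real N \<le> real k" by simp
        then show ?case using N by linarith
      qed
      then show "(\<lambda>k. max (- real k) (min (real k) (x + \<kappa>)) - max (- real k) (min (real k) x)) \<longlonglongrightarrow> \<kappa>"
        by (rule tendsto_eventually)
    qed
  qed auto
  then show ?thesis using prob_space by simp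
qed

text \<open>Centring at \<open>\<theta> n\<close> instead of \<open>\<theta>'\<close> subtracts
  exactly \<kappa> from the normalized statistic, yet the two centred statistics have the same limit
  L, one under the tilted and one under the original law. Passing to the limit in
  \<open>PiM_tilt_bound\<close> thus compares L with its own translate. The equalities are only
  eventual because a path follows its tilt only near t = 0.\<close>

lemma regular_shift_bound:
  fixes s :: "'a \<Rightarrow> real" and L :: "real measure"
  assumes M: "prob_space M" and s [measurable]: "s \<in> borel_measurable M"
    and sB: "\<And>x. \<bar>s x\<bar> \<le> B" and mean: "(\<integral>x. s x \<partial>M) = 0"
    and L: "real_distribution L" and L2: "integrable L (\<lambda>x. x\<^sup>2)"
    and T: "\<And>n. T n \<in> borel_measurable (PiM {..<n} (\<lambda>_. M))"
    and wc0: "weak_conv_m (\<lambda>n. distr (PiM {..<n} (\<lambda>_. M)) borel (\<lambda>\<omega>. sqrt (real n) * (T n \<omega> - \<theta>'))) L"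
    and P: "\<And>n. prob_space (P n)" "\<And>n. sets (P n) = sets M"
    and P_eq: "\<forall>\<^sub>F n in sequentially. P n = density M (\<lambda>x. ennreal (1 + 1 / sqrt (real n) * s x))"
    and \<theta>_eq: "\<forall>\<^sub>F n in sequentially. \<theta> n = \<theta>' + 1 / sqrt (real n) * \<kappa>"
    and wc1: "weak_conv_m (\<lambda>n. distr (PiM {..<n} (\<lambda>_. P n)) borel (\<lambda>\<omega>. sqrt (real n) * (T n \<omega> - \<theta> n))) L"
  shows "\<kappa>\<^sup>2 \<le> (exp (\<integral>x. (s x)\<^sup>2 \<partial>M) - 1) * (\<integral>x. x\<^sup>2 \<partial>L)"
proof -
  interpret L: real_distribution L by fact
  interpret M: prob_space M by fact
  define J where "J = (\<integral>x. (s x)\<^sup>2 \<partial>M)"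
  have J: "0 \<le> J" by (simp add: J_def)
  note [measurable] = T
  define \<mu>0 where "\<mu>0 n = distr (PiM {..<n} (\<lambda>_. M)) borel (\<lambda>\<omega>. sqrt (real n) * (T n \<omega> - \<theta>'))" for n
  define \<mu>1 where "\<mu>1 n = distr (PiM {..<n} (\<lambda>_. P n)) borel (\<lambda>\<omega>. sqrt (real n) * (T n \<omega> - \<theta> n))" for n
  have setsP: "sets (PiM {..<n} (\<lambda>_. P n)) = sets (PiM {..<n} (\<lambda>_. M))" for n
    using P(2) by (intro sets_PiM_cong) auto
  have T': "T n \<in> borel_measurable (PiM {..<n} (\<lambda>_. P n))" for n
    using T[of n] measurable_cong_sets[OF setsP refl] by blast
  have ps0: "prob_space (PiM {..<n} (\<lambda>_. M))" for n
    by (rule prob_space_PiM) (rule M)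
  have ps1: "prob_space (PiM {..<n} (\<lambda>_. P n))" for n
    by (rule prob_space_PiM) (rule P)
  have rd0: "real_distribution (\<mu>0 n)" for n
    unfolding \<mu>0_def by (rule prob_space.real_distribution_distr[OF ps0]) simp
  have rd1: "real_distribution (\<mu>1 n)" for n
    unfolding \<mu>1_def by (rule prob_space.real_distribution_distr[OF ps1]) (use T' in measurable)
  have main: "(\<integral>x. f x - f (x - \<kappa>) \<partial>L)\<^sup>2 \<le> (exp J - 1) * (\<integral>x. (f (x - \<kappa>))\<^sup>2 \<partial>L)"
    if cf: "\<And>x. isCont f x" and fH: "\<And>x. \<bar>f x\<bar> \<le> H" for f :: "real \<Rightarrow> real" and H
  proof -
    have [measurable]: "f \<in> borel_measurable borel"
      using cf by (intro borel_measurable_continuous_onI continuous_at_imp_continuous_on) auto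
    have fi: "integrable L (\<lambda>x. f x)" "integrable L (\<lambda>x. f (x - \<kappa>))"
      using fH by (auto intro!: L.integrable_const_bound[of _ H])
    have l1: "(\<lambda>n. \<integral>x. f x \<partial>\<mu>1 n) \<longlonglongrightarrow> (\<integral>x. f x \<partial>L)"
      by (rule weak_conv_imp_integral_bdd_continuous_conv[OF rd1 L]) (use wc1 cf fH in \<open>auto simp: \<mu>1_def\<close>)
    have sh: "isCont (\<lambda>x. f (x - \<kappa>)) x" for x
      by (rule continuous_at_compose[unfolded o_def, of x "\<lambda>x. x - \<kappa>" f]) (auto simp: cf)
    have l2: "(\<lambda>n. \<integral>x. f (x - \<kappa>) \<partial>\<mu>0 n) \<longlonglongrightarrow> (\<integral>x. f (x - \<kappa>) \<partial>L)"
      by (rule weak_conv_imp_integral_bdd_continuous_conv[OF rd0 L]) (use wc0 sh fH in \<open>auto simp: \<mu>0_def\<close>)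
    have l3: "(\<lambda>n. \<integral>x. (f (x - \<kappa>))\<^sup>2 \<partial>\<mu>0 n) \<longlonglongrightarrow> (\<integral>x. (f (x - \<kappa>))\<^sup>2 \<partial>L)"
    proof (rule weak_conv_imp_integral_bdd_continuous_conv[OF rd0 L])
      show "weak_conv_m \<mu>0 L" using wc0 by (simp add: \<mu>0_def[abs_def])
      show "isCont (\<lambda>x. (f (x - \<kappa>))\<^sup>2) x" for x using sh by (intro continuous_intros)
      show "norm ((f (x - \<kappa>))\<^sup>2) \<le> H\<^sup>2" for x
        using fH[of "x - \<kappa>"] power_mono[of "\<bar>f (x - \<kappa>)\<bar>" H 2] by simp
    qed
    \<comment> \<open>From n \<ge> B^2 on, |t| B \<le> 1 holds at t = 1 / sqrt n, as
      \<open>PiM_tilt_bound\<close> demands.\<close>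
    obtain N0 :: nat where N0: "B\<^sup>2 \<le> N0" using real_arch_simple by blast
    have ev: "\<forall>\<^sub>F n in sequentially. ((\<integral>x. f x \<partial>\<mu>1 n) - (\<integral>x. f (x - \<kappa>) \<partial>\<mu>0 n))\<^sup>2
          \<le> (exp J - 1) * (\<integral>x. (f (x - \<kappa>))\<^sup>2 \<partial>\<mu>0 n)"
      using P_eq \<theta>_eq eventually_gt_at_top[of 0] eventually_ge_at_top[of N0]
    proof eventually_elim
      case (elim n)
      let ?h = "\<lambda>\<omega>. f (sqrt (real n) * (T n \<omega> - \<theta>') - \<kappa>)"
      have h: "?h \<in> borel_measurable (PiM {..<n} (\<lambda>_. M))" by measurable
      have hP: "(\<lambda>\<omega>. sqrt (real n) * (T n \<omega> - \<theta> n)) \<in> borel_measurable (PiM {..<n} (\<lambda>_. P n))"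
        using T' by measurable
      have e1: "sqrt (real n) * (T n \<omega> - \<theta> n) = sqrt (real n) * (T n \<omega> - \<theta>') - \<kappa>" for \<omega>
        using elim by (simp add: field_simps)
      have "B\<^sup>2 \<le> real n" using N0 elim by (smt (verit) of_nat_le_iff)
      then have "B \<le> sqrt (real n)" by (rule real_le_rsqrt)
      then have tB: "\<bar>1 / sqrt (real n)\<bar> * B \<le> 1" using elim by (simp add: field_simps)
      have "(\<integral>x. f x \<partial>\<mu>1 n) = (\<integral>\<omega>. ?h \<omega> \<partial>PiM {..<n} (\<lambda>_. P n))"
        unfolding \<mu>1_def by (subst integral_distr[OF hP]) (auto simp: e1)
      moreover have "(\<integral>x. f (x - \<kappa>) \<partial>\<mu>0 n) = (\<integral>\<omega>. ?h \<omega> \<partial>PiM {..<n} (\<lambda>_. M))"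
        unfolding \<mu>0_def by (subst integral_distr) auto
      moreover have "(\<integral>x. (f (x - \<kappa>))\<^sup>2 \<partial>\<mu>0 n) = (\<integral>\<omega>. (?h \<omega>)\<^sup>2 \<partial>PiM {..<n} (\<lambda>_. M))"
        unfolding \<mu>0_def by (subst integral_distr) auto
      moreover have "real n * (1 / sqrt (real n))\<^sup>2 = 1" using elim by (simp add: power_divide)
      ultimately show ?case
        using PiM_tilt_bound[OF M s sB mean tB h, of H] fH elim(1) by (simp add: J_def)
    qed
    have "((\<integral>x. f x \<partial>L) - (\<integral>x. f (x - \<kappa>) \<partial>L))\<^sup>2 \<le> (exp J - 1) * (\<integral>x. (f (x - \<kappa>))\<^sup>2 \<partial>L)"
      by (rule tendsto_le[OF sequentially_bot _ _ ev]) (intro tendsto_intros l1 l2 l3)+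
    then show ?thesis using fi by simp
  qed
  define c where "c k x = max (- real k) (min (real k) x)" for k and x :: real
  have cc: "isCont (\<lambda>x. c k (x + \<kappa>)) x" for k x
    unfolding c_def by (intro continuous_intros)
  have [measurable]: "c k \<in> borel_measurable borel" for k
    unfolding c_def by measurable
  have ck: "\<bar>c k x\<bar> \<le> real k" for k x unfolding c_def by auto
  \<comment> \<open>Choosing f(x) = c_k(x + \<kappa>) leaves the clamped identity itself under the
    square on the right, and its second moment stays below that of L for every k.\<close>
  have b: "(\<integral>x. c k (x + \<kappa>) - c k x \<partial>L)\<^sup>2 \<le> (exp J - 1) * (\<integral>x. x\<^sup>2 \<partial>L)" for k
  proof -
    have "(\<integral>x. c k (x + \<kappa>) - c k x \<partial>L)\<^sup>2 \<le> (exp J - 1) * (\<integral>x. (c k x)\<^sup>2 \<partial>L)"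
      using main[of "\<lambda>x. c k (x + \<kappa>)" "real k"] cc ck by simp
    also have "(\<integral>x. (c k x)\<^sup>2 \<partial>L) \<le> (\<integral>x. x\<^sup>2 \<partial>L)"
    proof (rule integral_mono_AE'[OF L2])
      show "AE x in L. (c k x)\<^sup>2 \<le> x\<^sup>2"
        by (auto simp: c_def abs_le_square_iff[symmetric])
    qed auto
    finally show ?thesis using J by (simp add: mult_left_mono)
  qed
  have "(\<lambda>k. (\<integral>x. c k (x + \<kappa>) - c k x \<partial>L)\<^sup>2) \<longlonglongrightarrow> \<kappa>\<^sup>2"
    unfolding c_def by (intro tendsto_intros clamp_shift_tendsto L)
  then show ?thesis
    using b unfolding J_def[symmetric] by (intro LIMSEQ_le_const2) auto
qed

section \<open>The observed law\<close>

definition arm :: "bool \<Rightarrow> real \<times> real \<Rightarrow> real" where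
  "arm d p = (if d then fst p else snd p)"

lemma arm_measurable [measurable]: "arm d \<in> borel_measurable borel"
  unfolding arm_def by (cases d) (auto intro!: borel_measurable_continuous_onI continuous_intros)

lemma mu_arm: "mu S d x = (\<integral>p. arm d p \<partial>ky S x)"
  by (simp add: mu_def arm_def)

lemma sig2_arm: "sig2 S d x = (\<integral>p. (arm d p - mu S d x)\<^sup>2 \<partial>ky S x)"
  by (simp add: sig2_def arm_def)

lemma sets_obs_law [simp, measurable_cong]: "sets (obs_law S) = sets Mobs"
  by (simp add: obs_law_def)

text \<open>An event consists of at most four pairs, so its probability is a polynomial in
  \<open>p x\<close> and \<open>q x\<close>.\<close>

lemma measurable_bernoulli_pair:
  fixes p q :: "'a \<Rightarrow> real"
  assumes [measurable]: "p \<in> borel_measurable M" "q \<in> borel_measurable M"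
    and "\<And>x. 0 \<le> p x" "\<And>x. p x \<le> 1" "\<And>x. 0 \<le> q x" "\<And>x. q x \<le> 1"
  shows "(\<lambda>x. measure_pmf (pair_pmf (bernoulli_pmf (p x)) (bernoulli_pmf (q x))))
           \<in> M \<rightarrow>\<^sub>M prob_algebra (count_space UNIV)"
proof (rule measurable_prob_algebraI[OF measure_pmf.prob_space_axioms],
    rule measurable_subprob_algebra[OF measure_pmf.subprob_space_axioms])
  fix A :: "(bool \<times> bool) set"
  have "emeasure (measure_pmf (pair_pmf (bernoulli_pmf (p x)) (bernoulli_pmf (q x)))) A
      = (indicator A (True, True) * ennreal (q x) + indicator A (True, False) * ennreal (1 - q x)) * ennreal (p x)
      + (indicator A (False, True) * ennreal (q x) + indicator A (False, False) * ennreal (1 - q x)) * ennreal (1 - p x)" for x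
    using assms(3-) by (subst nn_integral_indicator[symmetric])
      (simp_all del: nn_integral_indicator add: nn_integral_pair_pmf')
  then show "(\<lambda>x. emeasure (measure_pmf (pair_pmf (bernoulli_pmf (p x)) (bernoulli_pmf (q x)))) A) \<in> borel_measurable M"
    by simp
qed simp

lemma count_space_bool_pair:
  "count_space (UNIV :: (bool \<times> bool) set) = count_space UNIV \<Otimes>\<^sub>M count_space UNIV"
  by (simp add: pair_measure_count_space)

text \<open>Collects the measurability and range clauses of \<open>in_model\<close> without the
  moment bounds. A tilted process is shown to satisfy these first, so that its observed law can be
  computed before it is known to lie in the model.\<close>

locale dgp_kernel =
  fixes S :: "'x::euclidean_space dgp"
  assumes px_prob: "prob_space (px S)" and sets_px [simp, measurable_cong]: "sets (px S) = sets borel"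
    and pi1_meas [measurable]: "pi1 S \<in> borel_measurable borel"
    and e1_meas [measurable]: "e1 S \<in> borel_measurable borel"
    and bounds: "\<And>x. 0 \<le> pi1 S x" "\<And>x. pi1 S x \<le> 1" "\<And>x. 0 \<le> e1 S x" "\<And>x. e1 S x \<le> 1"
    and ky_meas [measurable]: "ky S \<in> borel \<rightarrow>\<^sub>M prob_algebra borel"
begin

lemma space_px [simp]: "space (px S) = UNIV"
  using sets_eq_imp_space_eq[OF sets_px] by simp

lemma ky_prob: "prob_space (ky S x)" and sets_ky [simp]: "sets (ky S x) = sets borel"
  using measurable_space[OF ky_meas, of x] by (auto simp: space_prob_algebra)

lemma space_ky [simp]: "space (ky S x) = UNIV"
  using sets_eq_imp_space_eq[OF sets_ky] by simp

lemma ky_measurable_iff [simp]: "f \<in> measurable (ky S x) N \<longleftrightarrow> f \<in> measurable borel N"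
  using measurable_cong_sets[OF sets_ky refl] by blast

lemma ky_subprob [measurable]: "ky S \<in> borel \<rightarrow>\<^sub>M subprob_algebra borel"
  by (rule measurable_prob_algebraD) measurable

lemma gprop_measurable [measurable]: "gprop S d \<in> borel_measurable borel"
  unfolding gprop_def by measurable

lemma gprop_nonneg: "0 \<le> gprop S d x"
  using bounds by (auto simp: gprop_def)

lemma gprop_sum: "gprop S True x + gprop S False x = pi1 S x"
  by (simp add: gprop_def algebra_simps)

lemma full_kernel_measurable:
  "(\<lambda>x. distr (measure_pmf (pair_pmf (bernoulli_pmf (pi1 S x)) (bernoulli_pmf (e1 S x))) \<Otimes>\<^sub>M ky S x)
      Mfull (\<lambda>((ob, d), (y1, y0)). (x, ob, d, y1, y0))) \<in> borel \<rightarrow>\<^sub>M prob_algebra Mfull"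
proof (rule measurable_distr_prob_space2[where M="count_space UNIV \<Otimes>\<^sub>M (borel \<Otimes>\<^sub>M borel)"])
  show "(\<lambda>x. measure_pmf (pair_pmf (bernoulli_pmf (pi1 S x)) (bernoulli_pmf (e1 S x))) \<Otimes>\<^sub>M ky S x)
      \<in> borel \<rightarrow>\<^sub>M prob_algebra (count_space UNIV \<Otimes>\<^sub>M (borel \<Otimes>\<^sub>M borel))"
    using ky_meas by (intro measurable_pair_prob measurable_bernoulli_pair) (auto simp: bounds borel_prod)
  have "(\<lambda>q. (fst q, fst (fst (snd q)), snd (fst (snd q)), fst (snd (snd q)), snd (snd (snd q))))
     \<in> borel \<Otimes>\<^sub>M (count_space (UNIV::(bool\<times>bool) set) \<Otimes>\<^sub>M (borel \<Otimes>\<^sub>M borel)) \<rightarrow>\<^sub>M Mfull"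
    unfolding Mfull_def count_space_bool_pair by measurable
  then show "(\<lambda>(x, (ob, d), y1, y0). (x, ob, d, y1, y0))
     \<in> borel \<Otimes>\<^sub>M (count_space UNIV \<Otimes>\<^sub>M (borel \<Otimes>\<^sub>M borel)) \<rightarrow>\<^sub>M Mfull"
    by (simp add: case_prod_beta')
qed

lemma obs_map_measurable [measurable]: "obs_map \<in> Mfull \<rightarrow>\<^sub>M Mobs"
  unfolding obs_map_def Mfull_def Mobs_def case_prod_beta' by measurable

lemma sets_full_law [simp, measurable_cong]: "sets (full_law S) = sets Mfull"
  unfolding full_law_def by (rule sets_bind) (auto simp: px_prob prob_space.not_empty)

lemma prob_space_obs_law: "prob_space (obs_law S)"
proof -
  have "prob_space (full_law S)"
    unfolding full_law_def
    by (rule prob_space_bind'[where N=Mfull and M=borel])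
       (auto intro: full_kernel_measurable simp: space_prob_algebra px_prob)
  then show ?thesis unfolding obs_law_def
    by (rule prob_space.prob_space_distr) measurable
qed

text \<open>An observation falls into one of three cells: treated, control, or missing with the
  dummy value. Each observed cell sees a single arm of \<open>ky S x\<close>, so the coupling of the
  potential outcomes is invisible.\<close>

lemma nn_integral_obs_law:
  assumes f [measurable]: "f \<in> borel_measurable Mobs"
  shows "(\<integral>\<^sup>+z. f z \<partial>obs_law S) =
    (\<integral>\<^sup>+x. ennreal (gprop S True x) * (\<integral>\<^sup>+p. f (x, True, True, arm True p) \<partial>ky S x)
        + ennreal (gprop S False x) * (\<integral>\<^sup>+p. f (x, True, False, arm False p) \<partial>ky S x)
        + ennreal (1 - pi1 S x) * f (x, False, False, 0) \<partial>px S)"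
proof -
  let ?B = "\<lambda>x. measure_pmf (pair_pmf (bernoulli_pmf (pi1 S x)) (bernoulli_pmf (e1 S x)))"
  let ?K = "\<lambda>x. distr (?B x \<Otimes>\<^sub>M ky S x) Mfull (\<lambda>((ob, d), (y1, y0)). (x, ob, d, y1, y0))"
  have K: "?K \<in> px S \<rightarrow>\<^sub>M subprob_algebra Mfull"
    using measurable_prob_algebraD[OF full_kernel_measurable] measurable_cong_sets[OF sets_px refl] by blast
  have "(\<integral>\<^sup>+z. f z \<partial>obs_law S) = (\<integral>\<^sup>+w. f (obs_map w) \<partial>full_law S)"
    unfolding obs_law_def by (subst nn_integral_distr) auto
  also have "\<dots> = (\<integral>\<^sup>+x. \<integral>\<^sup>+w. f (obs_map w) \<partial>?K x \<partial>px S)"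
    unfolding full_law_def by (rule nn_integral_bind[OF _ K]) measurable
  also have "\<dots> = (\<integral>\<^sup>+x. ennreal (gprop S True x) * (\<integral>\<^sup>+p. f (x, True, True, arm True p) \<partial>ky S x)
        + ennreal (gprop S False x) * (\<integral>\<^sup>+p. f (x, True, False, arm False p) \<partial>ky S x)
        + ennreal (1 - pi1 S x) * f (x, False, False, 0) \<partial>px S)"
  proof (rule nn_integral_cong)
    fix x
    interpret ky: prob_space "ky S x" by (rule ky_prob)
    have m: "(\<lambda>((ob, d), (y1, y0)). (x, ob, d, y1, y0)) \<in> ?B x \<Otimes>\<^sub>M ky S x \<rightarrow>\<^sub>M Mfull"
    proof -
      have "(\<lambda>q. (x, fst (fst q), snd (fst q), fst (snd q), snd (snd q)))
        \<in> count_space (UNIV::(bool\<times>bool) set) \<Otimes>\<^sub>M (borel \<Otimes>\<^sub>M borel) \<rightarrow>\<^sub>M Mfull"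
        unfolding Mfull_def count_space_bool_pair by measurable
      moreover have "sets (?B x \<Otimes>\<^sub>M ky S x) = sets (count_space (UNIV::(bool\<times>bool) set) \<Otimes>\<^sub>M (borel \<Otimes>\<^sub>M borel))"
        by (rule sets_pair_measure_cong) (simp, simp only: borel_prod sets_ky)
      ultimately show ?thesis using measurable_cong_sets by (simp add: case_prod_beta') blast
    qed
    have fm [measurable]: "(\<lambda>p. f (x, o', d', arm d p)) \<in> borel_measurable borel" for o' d' d
      by (rule measurable_compose[OF _ f]) (unfold Mobs_def, measurable)
    have "(\<integral>\<^sup>+w. f (obs_map w) \<partial>?K x)
        = (\<integral>\<^sup>+q. f (obs_map ((\<lambda>((ob, d), (y1, y0)). (x, ob, d, y1, y0)) q)) \<partial>(?B x \<Otimes>\<^sub>M ky S x))"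
      by (rule nn_integral_distr[OF m]) measurable
    also have "\<dots> = (\<integral>\<^sup>+c. \<integral>\<^sup>+p. f (obs_map ((\<lambda>((ob, d), (y1, y0)). (x, ob, d, y1, y0)) (c, p))) \<partial>ky S x \<partial>?B x)"
      by (rule ky.nn_integral_fst[symmetric]) (use m in measurable)
    also have "\<dots> = (\<integral>\<^sup>+c. \<integral>\<^sup>+p. f (x, fst c, if fst c then snd c else False, if fst c then arm (snd c) p else 0) \<partial>ky S x \<partial>?B x)"
      by (intro nn_integral_cong arg_cong[of _ _ f]) (auto simp: obs_map_def arm_def split: prod.splits)
    also have "\<dots> = ((\<integral>\<^sup>+p. f (x, True, True, arm True p) \<partial>ky S x) * e1 S x
         + (\<integral>\<^sup>+p. f (x, True, False, arm False p) \<partial>ky S x) * (1 - e1 S x)) * pi1 S x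
         + (f (x, False, False, 0) * e1 S x + f (x, False, False, 0) * (1 - e1 S x)) * (1 - pi1 S x)"
      using bounds[of x] by (simp add: nn_integral_pair_pmf' ky.emeasure_space_1[simplified])
    also have "f (x, False, False, 0) * e1 S x + f (x, False, False, 0) * (1 - e1 S x) = f (x, False, False, 0)"
      using bounds[of x] by (simp add: distrib_left[symmetric] ennreal_plus[symmetric] del: ennreal_plus)
    also have "((\<integral>\<^sup>+p. f (x, True, True, arm True p) \<partial>ky S x) * e1 S x
         + (\<integral>\<^sup>+p. f (x, True, False, arm False p) \<partial>ky S x) * (1 - e1 S x)) * pi1 S x
         + f (x, False, False, 0) * (1 - pi1 S x) = ennreal (gprop S True x) * (\<integral>\<^sup>+p. f (x, True, True, arm True p) \<partial>ky S x)
        + ennreal (gprop S False x) * (\<integral>\<^sup>+p. f (x, True, False, arm False p) \<partial>ky S x)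
        + ennreal (1 - pi1 S x) * f (x, False, False, 0)"
      using bounds[of x] by (simp add: gprop_def ennreal_mult distrib_left distrib_right mult_ac)
    finally show "(\<integral>\<^sup>+w. f (obs_map w) \<partial>?K x) = \<dots>" .
  qed
  finally show ?thesis .
qed

end

text \<open>The general score of a path with fixed propensities: \<open>a\<close> moves the
  covariate law, \<open>b d\<close> the outcome law of arm d. A missing observation carries only the
  covariate part.\<close>

definition score :: "('x \<Rightarrow> real) \<Rightarrow> (bool \<Rightarrow> 'x \<Rightarrow> real \<Rightarrow> real) \<Rightarrow> 'x obs \<Rightarrow> real" where
  "score a b z = (case z of (x, ob, d, y) \<Rightarrow> a x + (if ob then b d x y else 0))"

lemma score_measurable [measurable]:
  fixes a :: "'x::euclidean_space \<Rightarrow> real"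
  assumes [measurable]: "a \<in> borel_measurable borel"
    and b: "\<And>d. (\<lambda>(x, y). b d x y) \<in> borel_measurable (borel \<Otimes>\<^sub>M borel)"
  shows "score a b \<in> borel_measurable Mobs"
proof -
  have [measurable]: "(\<lambda>z. b d (fst z) (snd (snd (snd z)))) \<in> borel_measurable Mobs" for d
    using measurable_compose[OF _ b, of "\<lambda>z. (fst z, snd (snd (snd z)))" Mobs d]
    by (simp add: Mobs_def)
  have [measurable]: "Measurable.pred Mobs (\<lambda>z. fst (snd z))" "Measurable.pred Mobs (\<lambda>z. fst (snd (snd z)))"
    "fst \<in> Mobs \<rightarrow>\<^sub>M borel"
    by (simp_all add: Mobs_def)
  have "score a b = (\<lambda>z. a (fst z) + (if fst (snd z) then
      (if fst (snd (snd z)) then b True (fst z) (snd (snd (snd z))) else b False (fst z) (snd (snd (snd z)))) else 0))"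
    by (auto simp: score_def fun_eq_iff)
  also have "\<dots> \<in> borel_measurable Mobs"
    by measurable
  finally show ?thesis .
qed

text \<open>The conditional mean 0 of \<open>b\<close> kills the cross terms, and the three cell
  weights attached to the square of \<open>a\<close> add up to 1. Nonnegative integrals let the same
  formula serve the unbounded efficient influence function and its bounded truncations.\<close>

lemma (in dgp_kernel) nn_integral_score_square:
  assumes a [measurable]: "a \<in> borel_measurable borel"
    and b [measurable]: "\<And>d. (\<lambda>(x, y). b d x y) \<in> borel_measurable (borel \<Otimes>\<^sub>M borel)"
    and b1: "\<And>d x. integrable (ky S x) (\<lambda>p. b d x (arm d p))"
    and b2: "\<And>d x. integrable (ky S x) (\<lambda>p. (b d x (arm d p))\<^sup>2)"
    and b0: "\<And>d x. (\<integral>p. b d x (arm d p) \<partial>ky S x) = 0"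
  shows "(\<integral>\<^sup>+z. ennreal ((score a b z)\<^sup>2) \<partial>obs_law S)
    = (\<integral>\<^sup>+x. ennreal ((a x)\<^sup>2 + gprop S True x * (\<integral>p. (b True x (arm True p))\<^sup>2 \<partial>ky S x)
         + gprop S False x * (\<integral>p. (b False x (arm False p))\<^sup>2 \<partial>ky S x)) \<partial>px S)"
proof -
  have m: "(\<lambda>z. ennreal ((score a b z)\<^sup>2)) \<in> borel_measurable Mobs" by measurable
  show ?thesis
    unfolding nn_integral_obs_law[OF m]
  proof (rule nn_integral_cong)
    fix x
    interpret ky: prob_space "ky S x" by (rule ky_prob)
    have *: "(\<integral>\<^sup>+p. ennreal ((score a b (x, True, d, arm d p))\<^sup>2) \<partial>ky S x)
        = ennreal ((a x)\<^sup>2 + (\<integral>p. (b d x (arm d p))\<^sup>2 \<partial>ky S x))" for d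
    proof -
      have "(\<integral>\<^sup>+p. ennreal ((score a b (x, True, d, arm d p))\<^sup>2) \<partial>ky S x)
         = (\<integral>\<^sup>+p. ennreal ((a x)\<^sup>2 + 2 * a x * b d x (arm d p) + (b d x (arm d p))\<^sup>2) \<partial>ky S x)"
        by (intro nn_integral_cong arg_cong[of _ _ ennreal]) (simp add: score_def power2_eq_square algebra_simps)
      also have "\<dots> = ennreal (\<integral>p. (a x)\<^sup>2 + 2 * a x * b d x (arm d p) + (b d x (arm d p))\<^sup>2 \<partial>ky S x)"
      proof (rule nn_integral_eq_integral)
        show "AE p in ky S x. 0 \<le> (a x)\<^sup>2 + 2 * a x * b d x (arm d p) + (b d x (arm d p))\<^sup>2"
        proof (rule AE_I2)
          fix p show "0 \<le> (a x)\<^sup>2 + 2 * a x * b d x (arm d p) + (b d x (arm d p))\<^sup>2"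
            using zero_le_power2[of "a x + b d x (arm d p)"] by (simp add: power2_sum algebra_simps)
        qed
      qed (use b1 b2 in auto)
      also have "(\<integral>p. (a x)\<^sup>2 + 2 * a x * b d x (arm d p) + (b d x (arm d p))\<^sup>2 \<partial>ky S x)
         = (a x)\<^sup>2 + (\<integral>p. (b d x (arm d p))\<^sup>2 \<partial>ky S x)"
        using b1[where d=d and x=x] b2[where d=d and x=x] b0[where d=d and x=x] ky.prob_space by simp
      finally show ?thesis .
    qed
    let ?I = "\<lambda>d. \<integral>p. (b d x (arm d p))\<^sup>2 \<partial>ky S x"
    have I: "0 \<le> ?I d" for d by simp
    have "ennreal (gprop S True x) * ennreal ((a x)\<^sup>2 + ?I True) + ennreal (gprop S False x) * ennreal ((a x)\<^sup>2 + ?I False)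
        + ennreal (1 - pi1 S x) * ennreal ((a x)\<^sup>2)
       = ennreal (gprop S True x * ((a x)\<^sup>2 + ?I True) + gprop S False x * ((a x)\<^sup>2 + ?I False)
        + (1 - pi1 S x) * (a x)\<^sup>2)"
      using bounds[of x] gprop_nonneg I
      by (simp add: ennreal_mult[symmetric] ennreal_plus[symmetric] add_nonneg_nonneg mult_nonneg_nonneg del: ennreal_plus)
    also have "\<dots> = ennreal ((a x)\<^sup>2 + gprop S True x * ?I True + gprop S False x * ?I False)"
      by (simp add: gprop_sum[symmetric] algebra_simps)
    finally show "ennreal (gprop S True x) * (\<integral>\<^sup>+p. ennreal ((score a b (x, True, True, arm True p))\<^sup>2) \<partial>ky S x)
        + ennreal (gprop S False x) * (\<integral>\<^sup>+p. ennreal ((score a b (x, True, False, arm False p))\<^sup>2) \<partial>ky S x)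
        + ennreal (1 - pi1 S x) * ennreal ((score a b (x, False, False, 0))\<^sup>2)
      = ennreal ((a x)\<^sup>2 + gprop S True x * ?I True + gprop S False x * ?I False)"
      unfolding * by (simp add: score_def)
  qed
qed

section \<open>Paths with linear observed density\<close>

definition tilt_weight :: "('x \<Rightarrow> real) \<Rightarrow> (bool \<Rightarrow> 'x \<Rightarrow> real \<Rightarrow> real) \<Rightarrow> real \<Rightarrow> bool \<Rightarrow> 'x \<Rightarrow> real \<Rightarrow> real" where
  "tilt_weight a b t d x y = 1 + t * b d x y / (1 + t * a x)"

text \<open>The tilted potential outcomes are made independent given the covariates: only their marginals
  enter the observed law. Dividing by \<open>1 + t * a x\<close> makes the observed density exactly linear in \<open>t\<close>.\<close>

definition tilt :: "'x::euclidean_space dgp \<Rightarrow> ('x \<Rightarrow> real) \<Rightarrow> (bool \<Rightarrow> 'x \<Rightarrow> real \<Rightarrow> real) \<Rightarrow> real \<Rightarrow> 'x dgp" where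
  "tilt S a b t = S\<lparr> px := density (px S) (\<lambda>x. ennreal (1 + t * a x)),
     ky := (\<lambda>x. distr (density (ky S x) (\<lambda>p. ennreal (tilt_weight a b t True x (arm True p)))) borel (arm True)
       \<Otimes>\<^sub>M distr (density (ky S x) (\<lambda>p. ennreal (tilt_weight a b t False x (arm False p)))) borel (arm False)) \<rparr>"

text \<open>Conditional mean 0 at every covariate keeps each tilted arm law a probability measure;
  the common bound \<open>B\<close> makes one range of t work for all covariates.\<close>

locale score_direction = dgp_kernel S for S :: "'x::euclidean_space dgp" +
  fixes a :: "'x \<Rightarrow> real" and b :: "bool \<Rightarrow> 'x \<Rightarrow> real \<Rightarrow> real" and B :: real
  assumes a_meas [measurable]: "a \<in> borel_measurable borel" and a_bound: "\<And>x. \<bar>a x\<bar> \<le> B"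
    and a_mean: "(\<integral>x. a x \<partial>px S) = 0"
    and b_meas [measurable]: "\<And>d. (\<lambda>(x, y). b d x y) \<in> borel_measurable (borel \<Otimes>\<^sub>M borel)"
    and b_bound: "\<And>d x y. \<bar>b d x y\<bar> \<le> B"
    and b_mean: "\<And>d x. (\<integral>p. b d x (arm d p) \<partial>ky S x) = 0"
begin

lemma B_nonneg: "0 \<le> B"
  using a_bound[of undefined] by linarith

lemma score_bound: "\<bar>score a b z\<bar> \<le> 2 * B"
proof -
  obtain x ob d y where "z = (x, ob, d, y)" by (cases z)
  then show ?thesis using a_bound[of x] b_bound[of d x y] by (auto simp: score_def)
qed

lemma score_meas [measurable]: "score a b \<in> borel_measurable Mobs"
  by measurable

lemma b_meas1 [measurable]: "b d x \<in> borel_measurable borel"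
  using measurable_compose[OF measurable_Pair1'[of x borel borel] b_meas] by simp

lemma integrable_a: "integrable (px S) a"
proof -
  interpret prob_space "px S" by (rule px_prob)
  show ?thesis using a_bound by (intro integrable_const_bound[of _ B]) auto
qed

lemma integrable_b: "integrable (ky S x) (\<lambda>p. b d x (arm d p))"
proof -
  interpret prob_space "ky S x" by (rule ky_prob)
  show ?thesis using b_bound by (intro integrable_const_bound[of _ B]) auto
qed

lemma integrable_b_mult:
  assumes "integrable (ky S x) f"
  shows "integrable (ky S x) (\<lambda>p. b d x (arm d p) * f p)"
proof (rule Bochner_Integration.integrable_bound[of _ "\<lambda>p. B * f p"])
  show "AE p in ky S x. norm (b d x (arm d p) * f p) \<le> norm (B * f p)"
    using b_bound B_nonneg by (auto simp: abs_mult intro!: mult_right_mono)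
qed (use assms borel_measurable_integrable[OF assms] in auto)

end

text \<open>The factor 4 gives |t a| \<le> 1/4 and |t b| \<le> 1/4, so the denominator 1 + t a is at
  least 3/4 and the weights stay away from 0.\<close>

locale small_tilt = score_direction +
  fixes t :: real
  assumes t_small: "\<bar>t\<bar> * (4 * B) \<le> 1"
begin

abbreviation "w \<equiv> tilt_weight a b t"

lemma ta_bound: "\<bar>t * a x\<bar> \<le> 1 / 4" and tb_bound: "\<bar>t * b d x y\<bar> \<le> 1 / 4"
  using t_small mult_left_mono[OF a_bound, of "\<bar>t\<bar>" x] mult_left_mono[OF b_bound, of "\<bar>t\<bar>" d x y]
  by (auto simp: abs_mult)

lemma ta_pos: "3 / 4 \<le> 1 + t * a x" "0 < 1 + t * a x" "0 \<le> 1 + t * a x"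
  using ta_bound[of x] by linarith+

text \<open>Two uses: the bound linear in t controls the displacement of the variances, the constant
  one keeps the weights between 0 and 2.\<close>

lemma tb_quot: "\<bar>t * b d x y / (1 + t * a x)\<bar> \<le> 2 * \<bar>t\<bar> * B" "\<bar>t * b d x y / (1 + t * a x)\<bar> \<le> 1 / 2"
proof -
  have "\<bar>t * b d x y / (1 + t * a x)\<bar> = \<bar>t * b d x y\<bar> / (1 + t * a x)"
    using ta_pos(2)[of x] by (simp add: abs_mult)
  also have "\<dots> \<le> \<bar>t * b d x y\<bar> / (3 / 4)"
    using ta_pos[of x] by (intro divide_left_mono) auto
  finally have 1: "\<bar>t * b d x y / (1 + t * a x)\<bar> \<le> 4 / 3 * \<bar>t * b d x y\<bar>" by simp
  then show "\<bar>t * b d x y / (1 + t * a x)\<bar> \<le> 1 / 2"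
    using tb_bound[of d x y] by linarith
  have "\<bar>t * b d x y\<bar> \<le> \<bar>t\<bar> * B" by (simp add: abs_mult b_bound mult_left_mono)
  moreover have "0 \<le> \<bar>t\<bar> * B" using B_nonneg by simp
  ultimately show "\<bar>t * b d x y / (1 + t * a x)\<bar> \<le> 2 * \<bar>t\<bar> * B" using 1 by linarith
qed

lemma w_bounds: "0 \<le> w d x y" "w d x y \<le> 2"
  unfolding tilt_weight_def using tb_quot(2)[of d x y] by linarith+

lemma w_mult: "(1 + t * a x) * w d x y = 1 + t * (a x + b d x y)"
  using ta_pos(2)[of x] by (simp add: tilt_weight_def field_simps)

lemma w_meas [measurable]: "(\<lambda>(x, y). w d x y) \<in> borel_measurable (borel \<Otimes>\<^sub>M borel)"
  unfolding tilt_weight_def by measurable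

lemma w_meas1 [measurable]: "w d x \<in> borel_measurable borel"
  unfolding tilt_weight_def by measurable

lemma integrable_w_mult:
  assumes "integrable (ky S x) f"
  shows "integrable (ky S x) (\<lambda>p. w d x (arm d p) * f p)"
proof (rule Bochner_Integration.integrable_bound[of _ "\<lambda>p. 2 * f p"])
  show "AE p in ky S x. norm (w d x (arm d p) * f p) \<le> norm (2 * f p)"
    using w_bounds by (auto simp: abs_mult intro!: mult_right_mono)
qed (use assms borel_measurable_integrable[OF assms] in auto)

lemma integral_w_mult:
  assumes "integrable (ky S x) f"
  shows "(\<integral>p. w d x (arm d p) * f p \<partial>ky S x)
    = (\<integral>p. f p \<partial>ky S x) + t / (1 + t * a x) * (\<integral>p. b d x (arm d p) * f p \<partial>ky S x)"
proof -
  have "(\<integral>p. w d x (arm d p) * f p \<partial>ky S x)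
     = (\<integral>p. f p + t / (1 + t * a x) * (b d x (arm d p) * f p) \<partial>ky S x)"
    by (intro Bochner_Integration.integral_cong) (auto simp: tilt_weight_def algebra_simps)
  then show ?thesis using assms integrable_b_mult[OF assms, of d] by simp
qed

lemma prob_tilt_density: "prob_space (density (ky S x) (\<lambda>p. ennreal (w d x (arm d p))))"
proof
  interpret ky: prob_space "ky S x" by (rule ky_prob)
  have "emeasure (density (ky S x) (\<lambda>p. ennreal (w d x (arm d p)))) (space (ky S x))
      = (\<integral>\<^sup>+p. ennreal (w d x (arm d p)) \<partial>ky S x)"
    by (subst emeasure_density) (auto intro!: nn_integral_cong)
  also have "\<dots> = ennreal (\<integral>p. w d x (arm d p) * 1 \<partial>ky S x)"
    using integrable_w_mult[of x "\<lambda>_. 1" d] w_bounds by (subst nn_integral_eq_integral) auto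
  also have "\<dots> = 1" using b_mean[where d=d and x=x] ky.prob_space by (subst integral_w_mult) simp_all
  finally show "emeasure (density (ky S x) (\<lambda>p. ennreal (w d x (arm d p))))
    (space (density (ky S x) (\<lambda>p. ennreal (w d x (arm d p))))) = 1" by simp
qed

abbreviation "S' \<equiv> tilt S a b t"

lemma px_tilt: "px S' = density (px S) (\<lambda>x. ennreal (1 + t * a x))"
  and pi1_tilt [simp]: "pi1 S' = pi1 S" and e1_tilt [simp]: "e1 S' = e1 S"
  by (simp_all add: tilt_def)

lemma gprop_tilt [simp]: "gprop S' = gprop S"
  by (simp add: gprop_def fun_eq_iff)

abbreviation "armlaw d x \<equiv> distr (density (ky S x) (\<lambda>p. ennreal (w d x (arm d p)))) borel (arm d)"

lemma ky_tilt: "ky S' x = armlaw True x \<Otimes>\<^sub>M armlaw False x"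
  by (simp add: tilt_def)

lemma prob_armlaw: "prob_space (armlaw d x)"
  by (rule prob_space.prob_space_distr[OF prob_tilt_density]) simp

text \<open>Both factors are probability measures, so each projection of the product returns its
  factor; the second projection reduces to the first by a swap.\<close>

lemma distr_ky_tilt: "distr (ky S' x) borel (arm d) = armlaw d x"
proof -
  interpret T: prob_space "armlaw True x" by (rule prob_armlaw)
  interpret F: prob_space "armlaw False x" by (rule prob_armlaw)
  interpret P: pair_prob_space "armlaw True x" "armlaw False x" ..
  have c: "distr (ky S' x) borel (arm d) = distr (ky S' x) (armlaw d x) (arm d)"
    by (rule distr_cong) simp_all
  show ?thesis
  proof (cases d)
    case True
    have "distr (ky S' x) (armlaw True x) (arm True) = distr (armlaw True x \<Otimes>\<^sub>M armlaw False x) (armlaw True x) fst"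
      unfolding ky_tilt by (intro distr_cong) (auto simp: arm_def)
    then show ?thesis using c True F.distr_pair_fst by simp
  next
    case False
    have "distr (ky S' x) (armlaw False x) (arm False) = distr (armlaw True x \<Otimes>\<^sub>M armlaw False x) (armlaw False x) snd"
      unfolding ky_tilt by (intro distr_cong) (auto simp: arm_def)
    also have "\<dots> = armlaw False x"
      by (subst P.distr_pair_swap) (use T.distr_pair_fst in \<open>simp add: distr_distr o_def case_prod_beta'\<close>)
    finally show ?thesis using c False by simp
  qed
qed

lemma sets_ky_tilt: "sets (ky S' x) = sets borel"
  unfolding ky_tilt borel_prod[symmetric] by (intro sets_pair_measure_cong) auto

lemma ky_tilt_measurable_iff [simp]: "f \<in> measurable (ky S' x) N \<longleftrightarrow> f \<in> measurable borel N"
  using measurable_cong_sets[OF sets_ky_tilt refl] by blast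

text \<open>Restricted to functions of one arm, since the tilt replaces the joint law by a product
  and preserves no relation between the arms.\<close>

lemma nn_integral_ky_tilt:
  assumes [measurable]: "f \<in> borel_measurable borel"
  shows "(\<integral>\<^sup>+p. f (arm d p) \<partial>ky S' x) = (\<integral>\<^sup>+p. ennreal (w d x (arm d p)) * f (arm d p) \<partial>ky S x)"
proof -
  have "(\<integral>\<^sup>+p. f (arm d p) \<partial>ky S' x) = (\<integral>\<^sup>+y. f y \<partial>armlaw d x)"
    unfolding distr_ky_tilt[symmetric] by (subst nn_integral_distr) auto
  also have "\<dots> = (\<integral>\<^sup>+p. ennreal (w d x (arm d p)) * f (arm d p) \<partial>ky S x)"
    by (subst nn_integral_distr, simp, simp, subst nn_integral_density) auto
  finally show ?thesis .
qed

lemma integral_ky_tilt: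
  fixes f :: "real \<Rightarrow> real"
  assumes [measurable]: "f \<in> borel_measurable borel"
  shows "(\<integral>p. f (arm d p) \<partial>ky S' x) = (\<integral>p. w d x (arm d p) * f (arm d p) \<partial>ky S x)" (is ?A)
    and "integrable (ky S x) (\<lambda>p. f (arm d p)) \<Longrightarrow> integrable (ky S' x) (\<lambda>p. f (arm d p))" (is "_ \<Longrightarrow> ?B")
proof -
  have "(\<integral>p. f (arm d p) \<partial>ky S' x) = (\<integral>y. f y \<partial>armlaw d x)"
    unfolding distr_ky_tilt[symmetric] by (subst integral_distr) auto
  also have "\<dots> = (\<integral>p. w d x (arm d p) * f (arm d p) \<partial>ky S x)"
    by (subst integral_distr, simp, simp, subst integral_real_density) (auto simp: w_bounds)
  finally show ?A .
  assume "integrable (ky S x) (\<lambda>p. f (arm d p))"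
  then have "integrable (armlaw d x) f"
    using integrable_w_mult
    by (subst integrable_distr_eq, simp, simp, subst integrable_real_density) (auto simp: w_bounds)
  then show ?B
    unfolding distr_ky_tilt[symmetric] by (subst (asm) integrable_distr_eq) auto
qed

lemma ky_tilt_measurable: "ky S' \<in> borel \<rightarrow>\<^sub>M prob_algebra borel"
proof -
  have "(\<lambda>x. armlaw d x) \<in> borel \<rightarrow>\<^sub>M prob_algebra borel" for d
  proof (rule measurable_prob_algebraI[OF prob_armlaw],
      rule measurable_subprob_algebra[OF prob_space_imp_subprob_space[OF prob_armlaw]])
    fix A :: "real set" assume [measurable]: "A \<in> sets borel"
    have "emeasure (armlaw d x) A = (\<integral>\<^sup>+p. ennreal (w d x (arm d p)) * indicator A (arm d p) \<partial>ky S x)" for x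
      by (subst nn_integral_indicator[symmetric], simp, subst nn_integral_distr, simp, simp, subst nn_integral_density) auto
    moreover have "(\<lambda>x. \<integral>\<^sup>+p. ennreal (w d x (arm d p)) * indicator A (arm d p) \<partial>ky S x) \<in> borel_measurable borel"
      by (rule nn_integral_measurable_subprob_algebra2[OF _ ky_subprob]) measurable
    ultimately show "(\<lambda>x. emeasure (armlaw d x) A) \<in> borel_measurable borel" by simp
  qed simp
  then have "(\<lambda>x. armlaw True x \<Otimes>\<^sub>M armlaw False x) \<in> borel \<rightarrow>\<^sub>M prob_algebra (borel \<Otimes>\<^sub>M borel)"
    by (intro measurable_pair_prob)
  then show ?thesis by (simp add: ky_tilt[abs_def] borel_prod)
qed

lemma dgp_kernel_tilt: "dgp_kernel S'"
proof (rule dgp_kernel.intro)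
  show "prob_space (px S')" unfolding px_tilt
    by (rule prob_space_linear_tilt[OF px_prob]) (auto simp: integrable_a a_mean ta_pos)
  show "ky S' \<in> borel \<rightarrow>\<^sub>M prob_algebra borel" by (rule ky_tilt_measurable)
qed (auto simp: px_tilt bounds)

text \<open>On an observed cell the covariate factor 1 + t a cancels the denominator of the arm
  weight and leaves 1 + t (a + b); on the missing cell the covariate factor stands alone. Both are 1
  + t times the score, and the cell weights do not move.\<close>

lemma obs_law_tilt: "obs_law S' = density (obs_law S) (\<lambda>z. ennreal (1 + t * score a b z))"
proof (rule measure_eqI)
  interpret T: dgp_kernel S' by (rule dgp_kernel_tilt)
  have sc: "0 \<le> 1 + t * score a b z" for z
  proof -
    have "\<bar>t * score a b z\<bar> \<le> \<bar>t\<bar> * (2 * B)"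
      by (simp add: abs_mult mult_left_mono score_bound)
    also have "\<dots> \<le> 1" using t_small B_nonneg by (simp add: mult.left_commute)
    finally show ?thesis by linarith
  qed
  fix A assume "A \<in> sets (obs_law S')"
  then have A [measurable]: "A \<in> sets Mobs" by simp
  have [measurable]: "Measurable.pred borel (\<lambda>y. (x, o', d, y) \<in> A)" for x o' d
  proof -
    have "(\<lambda>y. (x, o', d, y)) \<in> borel \<rightarrow>\<^sub>M Mobs" unfolding Mobs_def by measurable
    from measurable_sets[OF this A] show ?thesis by (simp add: pred_def vimage_def)
  qed
  have "emeasure (obs_law S') A = (\<integral>\<^sup>+z. indicator A z \<partial>obs_law S')" by simp
  also have "\<dots> = (\<integral>\<^sup>+x. ennreal (1 + t * a x) * (ennreal (gprop S True x) * (\<integral>\<^sup>+p. indicator A (x, True, True, arm True p) \<partial>ky S' x)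
        + ennreal (gprop S False x) * (\<integral>\<^sup>+p. indicator A (x, True, False, arm False p) \<partial>ky S' x)
        + ennreal (1 - pi1 S x) * indicator A (x, False, False, 0)) \<partial>px S)"
  proof -
    have [measurable]: "(\<lambda>x. \<integral>\<^sup>+p. indicator A (x, True, d, arm d p) \<partial>ky S' x) \<in> borel_measurable borel" for d
    proof (rule nn_integral_measurable_subprob_algebra2[OF _ T.ky_subprob])
      have "(\<lambda>q. (fst q, True, d, arm d (snd q))) \<in> borel \<Otimes>\<^sub>M borel \<rightarrow>\<^sub>M Mobs"
        unfolding Mobs_def by measurable
      from measurable_compose[OF this borel_measurable_indicator[OF A]]
      show "(\<lambda>(x, p). indicator A (x, True, d, arm d p) :: ennreal) \<in> borel_measurable (borel \<Otimes>\<^sub>M borel)"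
        by (simp add: case_prod_beta')
    qed
    have [measurable]: "(\<lambda>x. indicator A (x, False, False, 0) :: ennreal) \<in> borel_measurable borel"
      by (rule measurable_compose[OF _ borel_measurable_indicator[OF A]]) (simp add: Mobs_def)
    show ?thesis
      by (subst T.nn_integral_obs_law, simp, unfold px_tilt, subst nn_integral_density) auto
  qed
  also have "\<dots> = (\<integral>\<^sup>+z. ennreal (1 + t * score a b z) * indicator A z \<partial>obs_law S)"
  proof (subst nn_integral_obs_law, measurable, rule nn_integral_cong)
    fix x
    have *: "ennreal (1 + t * a x) * (\<integral>\<^sup>+p. indicator A (x, True, d, arm d p) \<partial>ky S' x)
       = (\<integral>\<^sup>+p. ennreal (1 + t * score a b (x, True, d, arm d p)) * indicator A (x, True, d, arm d p) \<partial>ky S x)" for d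
    proof -
      have "(\<integral>\<^sup>+p. indicator A (x, True, d, arm d p) \<partial>ky S' x)
         = (\<integral>\<^sup>+p. ennreal (w d x (arm d p)) * indicator A (x, True, d, arm d p) \<partial>ky S x)"
        by (rule nn_integral_ky_tilt[of "\<lambda>y. indicator A (x, True, d, y)"]) measurable
      then have "ennreal (1 + t * a x) * (\<integral>\<^sup>+p. indicator A (x, True, d, arm d p) \<partial>ky S' x)
         = (\<integral>\<^sup>+p. ennreal (1 + t * a x) * (ennreal (w d x (arm d p)) * indicator A (x, True, d, arm d p)) \<partial>ky S x)"
        by (simp, subst nn_integral_cmult) auto
      also have "\<dots> = (\<integral>\<^sup>+p. ennreal (1 + t * score a b (x, True, d, arm d p)) * indicator A (x, True, d, arm d p) \<partial>ky S x)"
        by (intro nn_integral_cong)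
          (simp add: mult.assoc[symmetric] ennreal_mult[symmetric] ta_pos w_bounds w_mult score_def)
      finally show ?thesis .
    qed
    show "ennreal (1 + t * a x) * (ennreal (gprop S True x) * (\<integral>\<^sup>+p. indicator A (x, True, True, arm True p) \<partial>ky S' x)
        + ennreal (gprop S False x) * (\<integral>\<^sup>+p. indicator A (x, True, False, arm False p) \<partial>ky S' x)
        + ennreal (1 - pi1 S x) * indicator A (x, False, False, 0))
      = ennreal (gprop S True x) * (\<integral>\<^sup>+p. ennreal (1 + t * score a b (x, True, True, arm True p)) * indicator A (x, True, True, arm True p) \<partial>ky S x)
        + ennreal (gprop S False x) * (\<integral>\<^sup>+p. ennreal (1 + t * score a b (x, True, False, arm False p)) * indicator A (x, True, False, arm False p) \<partial>ky S x)
        + ennreal (1 - pi1 S x) * (ennreal (1 + t * score a b (x, False, False, 0)) * indicator A (x, False, False, 0))"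
      unfolding *[symmetric] by (simp add: score_def algebra_simps)
  qed
  also have "\<dots> = emeasure (density (obs_law S) (\<lambda>z. ennreal (1 + t * score a b z))) A"
    by (rule emeasure_density[symmetric]) auto
  finally show "emeasure (obs_law S') A = emeasure (density (obs_law S) (\<lambda>z. ennreal (1 + t * score a b z))) A" .
qed simp

end

section \<open>The paths stay in the model\<close>

context dgp_kernel
begin

text \<open>Pushing \<open>ky S x\<close> forward along p -> (x, p) turns the integrand, which
  depends on x, into one fixed function on the product space, where integration is measurable in the
  measure.\<close>

lemma kernel_integral_measurable [measurable (raw)]:
  fixes f :: "'x \<Rightarrow> real \<times> real \<Rightarrow> real"
  assumes [measurable]: "(\<lambda>(x, p). f x p) \<in> borel_measurable (borel \<Otimes>\<^sub>M borel)"
  shows "(\<lambda>x. \<integral>p. f x p \<partial>ky S x) \<in> borel_measurable borel"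
proof -
  have "(\<lambda>x. distr (ky S x) (borel \<Otimes>\<^sub>M borel) (\<lambda>p. (x, p))) \<in> borel \<rightarrow>\<^sub>M subprob_algebra (borel \<Otimes>\<^sub>M borel)"
    by (rule measurable_distr2[OF _ ky_subprob]) measurable
  from measurable_compose[OF this integral_measurable_subprob_algebra[OF assms]]
  have "(\<lambda>x. \<integral>q. (\<lambda>(x, p). f x p) q \<partial>distr (ky S x) (borel \<Otimes>\<^sub>M borel) (\<lambda>p. (x, p))) \<in> borel_measurable borel" .
  moreover have "(\<integral>q. (\<lambda>(x, p). f x p) q \<partial>distr (ky S x) (borel \<Otimes>\<^sub>M borel) (\<lambda>p. (x, p))) = (\<integral>p. f x p \<partial>ky S x)" for x
    by (subst integral_distr) auto
  ultimately show ?thesis by simp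
qed

lemma mu_measurable [measurable]: "mu S d \<in> borel_measurable borel"
  unfolding mu_arm by measurable

lemma cate_measurable [measurable]: "cate S \<in> borel_measurable borel"
  unfolding cate_def by measurable

lemma sig2_measurable [measurable]: "sig2 S d \<in> borel_measurable borel"
  unfolding sig2_arm by measurable

end

lemma in_model_dgp_kernel:
  assumes "in_model Clo Chi eps S"
  shows "dgp_kernel S"
  using assms by (intro dgp_kernel.intro) (auto simp: in_model_def)

locale model_point = dgp_kernel S for S :: "'x::euclidean_space dgp" +
  fixes Clo Chi eps :: real
  assumes model: "in_model Clo Chi eps S" and Clo_pos: "0 < Clo" and eps_pos: "0 < eps"
begin

lemma mu_bound: "\<bar>mu S d x\<bar> < Chi" and sig2_bounds: "Clo < sig2 S d x" "sig2 S d x < Chi"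
  using model by (auto simp: in_model_def)

lemma Chi_pos: "0 < Chi"
  using mu_bound[of True undefined] by linarith

lemma integrable_arm_sq: "integrable (ky S x) (\<lambda>p. (arm d p)\<^sup>2)"
  using model by (cases d) (auto simp: in_model_def arm_def)

lemma integrable_arm: "integrable (ky S x) (arm d)"
proof -
  interpret ky: prob_space "ky S x" by (rule ky_prob)
  show ?thesis by (rule ky.square_integrable_imp_integrable[OF _ integrable_arm_sq]) simp
qed

lemma integrable_const [simp]: "integrable (ky S x) (\<lambda>_. c :: real)"
proof -
  interpret ky: prob_space "ky S x" by (rule ky_prob)
  show ?thesis by simp
qed

lemma measure_ky_UNIV [simp]: "measure (ky S x) UNIV = 1"
proof -
  interpret ky: prob_space "ky S x" by (rule ky_prob)
  show ?thesis using ky.prob_space by simp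
qed

lemma integrable_arm_centered: "integrable (ky S x) (\<lambda>p. (arm d p - c)\<^sup>2)"
  using integrable_arm_sq[of x d] integrable_arm[of x d] by (simp add: power2_diff)

lemma second_moment_arm: "(\<integral>p. (arm d p)\<^sup>2 \<partial>ky S x) \<le> Chi + Chi\<^sup>2"
proof -
  have "sig2 S d x = (\<integral>p. (arm d p)\<^sup>2 - 2 * mu S d x * arm d p + (mu S d x)\<^sup>2 \<partial>ky S x)"
    unfolding sig2_arm by (intro Bochner_Integration.integral_cong) (auto simp: power2_eq_square algebra_simps)
  also have "\<dots> = (\<integral>p. (arm d p)\<^sup>2 \<partial>ky S x) - (mu S d x)\<^sup>2"
    using integrable_arm_sq[of x d] integrable_arm[of x d]
    by (simp add: mu_arm[symmetric] power2_eq_square)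
  finally have "(\<integral>p. (arm d p)\<^sup>2 \<partial>ky S x) = sig2 S d x + (mu S d x)\<^sup>2" by simp
  moreover have "(mu S d x)\<^sup>2 \<le> Chi\<^sup>2"
    using mu_bound[of d x] Chi_pos by (intro power2_le_iff_abs_le[THEN iffD2]) auto
  ultimately show ?thesis using sig2_bounds(2)[of d x] by linarith
qed

lemma cate_bound: "\<bar>cate S x\<bar> \<le> 2 * Chi"
  using mu_bound[of True x] mu_bound[of False x] by (auto simp: cate_def)

lemma integrable_px_bounded:
  fixes f :: "'x \<Rightarrow> real"
  assumes "f \<in> borel_measurable borel" "\<And>x. \<bar>f x\<bar> \<le> K"
  shows "integrable (px S) f"
proof -
  interpret prob_space "px S" by (rule px_prob)
  show ?thesis using assms by (intro integrable_const_bound[of _ K]) auto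
qed

end

text \<open>The conditional moments at x move only if \<open>b\<close> is nonzero there, so slack
  \<eta> is demanded exactly at such x, for both arms at once. The covariate part \<open>a\<close>
  needs no slack.\<close>

locale model_direction = model_point S Clo Chi eps + score_direction S a b B
  for S :: "'x::euclidean_space dgp" and Clo Chi eps a b B +
  fixes \<eta> :: real
  assumes margin_pos: "0 < \<eta>"
    and margin: "\<And>d d' x y. b d' x y \<noteq> 0 \<Longrightarrow>
      \<bar>mu S d x\<bar> < Chi - \<eta> \<and> Clo + \<eta> < sig2 S d x \<and> sig2 S d x < Chi - \<eta>"
begin

definition drift :: "bool \<Rightarrow> 'x \<Rightarrow> real" where
  "drift d x = (\<integral>p. b d x (arm d p) * arm d p \<partial>ky S x)"

text \<open>The product rule at t = 0: reweighting the covariates gives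
  \<open>a x * cate S x\<close>, moving the conditional means gives the difference of the
  drifts.\<close>

definition tau_deriv :: real where
  "tau_deriv = (\<integral>x. a x * cate S x + (drift True x - drift False x) \<partial>px S)"

text \<open>Comes from |y| \<le> 1 + y^2 together with the bound Chi + Chi^2 on the conditional
  second moments.\<close>

definition drift_bound :: real where
  "drift_bound = B * (1 + Chi + Chi\<^sup>2)"

lemma drift_measurable [measurable]: "drift d \<in> borel_measurable borel"
proof -
  have "(\<lambda>x. b d (fst x) (arm d (snd x))) \<in> borel_measurable (borel \<Otimes>\<^sub>M borel)"
    using measurable_compose[OF _ b_meas[of d], of "\<lambda>x. (fst x, arm d (snd x))" "borel \<Otimes>\<^sub>M borel"] by simp
  then show ?thesis
    unfolding drift_def by (intro kernel_integral_measurable) (simp add: case_prod_beta')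
qed

lemma drift_le: "\<bar>drift d x\<bar> \<le> drift_bound"
proof -
  have "\<bar>drift d x\<bar> \<le> (\<integral>p. \<bar>b d x (arm d p) * arm d p\<bar> \<partial>ky S x)"
    unfolding drift_def by (rule integral_abs_bound)
  also have "\<dots> \<le> (\<integral>p. B * (1 + (arm d p)\<^sup>2) \<partial>ky S x)"
  proof (rule integral_mono)
    show "integrable (ky S x) (\<lambda>p. \<bar>b d x (arm d p) * arm d p\<bar>)"
      using integrable_b_mult[OF integrable_arm] by simp
    fix p
    have "\<bar>arm d p\<bar> \<le> 1 + (arm d p)\<^sup>2"
    proof -
      have "0 \<le> (\<bar>arm d p\<bar> - 1)\<^sup>2" by simp
      then have "2 * \<bar>arm d p\<bar> \<le> 1 + (arm d p)\<^sup>2" by (simp add: power2_diff)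
      then show ?thesis using zero_le_power2[of "arm d p"] by linarith
    qed
    then show "\<bar>b d x (arm d p) * arm d p\<bar> \<le> B * (1 + (arm d p)\<^sup>2)"
      unfolding abs_mult by (intro mult_mono b_bound B_nonneg) auto
  qed (use integrable_arm_sq[of x d] in auto)
  also have "\<dots> = B * (1 + (\<integral>p. (arm d p)\<^sup>2 \<partial>ky S x))"
    using integrable_arm_sq[of x d] by simp
  also have "\<dots> \<le> drift_bound"
    unfolding drift_bound_def using second_moment_arm[of x d] B_nonneg by (intro mult_left_mono) auto
  finally show ?thesis .
qed

end

text \<open>The first two summands bound the displacement of the variance, the third that of the
  mean; |t| \<le> 1 allows t^2 to be replaced by |t|, which makes the condition linear.\<close>

locale model_tilt = model_direction S Clo Chi eps a b B \<eta> + small_tilt S a b B t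
  for S :: "'x::euclidean_space dgp" and Clo Chi eps a b B \<eta> t +
  assumes t_margin: "\<bar>t\<bar> \<le> 1" "\<bar>t\<bar> * (2 * B * Chi + 4 * drift_bound\<^sup>2 + 2 * drift_bound) < \<eta>"
begin

lemma mu_tilt: "mu S' d x = mu S d x + t / (1 + t * a x) * drift d x"
proof -
  have "mu S' d x = (\<integral>p. w d x (arm d p) * arm d p \<partial>ky S x)"
    unfolding mu_arm using integral_ky_tilt(1)[of "\<lambda>y. y", where d=d and x=x] by simp
  also have "\<dots> = mu S d x + t / (1 + t * a x) * drift d x"
    by (subst integral_w_mult[OF integrable_arm]) (simp add: mu_arm drift_def)
  finally show ?thesis .
qed

lemma mu_tilt_diff: "\<bar>mu S' d x - mu S d x\<bar> \<le> 2 * \<bar>t\<bar> * drift_bound"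
proof -
  have "\<bar>t / (1 + t * a x)\<bar> = \<bar>t\<bar> / (1 + t * a x)"
    using ta_pos(2)[of x] by simp
  also have "\<dots> \<le> \<bar>t\<bar> / (1 / 2)"
    by (rule divide_left_mono) (use ta_pos[of x] in simp_all)
  finally have "\<bar>t / (1 + t * a x)\<bar> \<le> 2 * \<bar>t\<bar>" by simp
  then have "\<bar>t / (1 + t * a x)\<bar> * \<bar>drift d x\<bar> \<le> 2 * \<bar>t\<bar> * drift_bound"
    by (rule mult_mono[OF _ drift_le]) simp_all
  then show ?thesis unfolding mu_tilt abs_mult[symmetric] add_diff_cancel_left' .
qed

text \<open>Under the new weights the variance is the second moment about the old mean minus the
  squared shift of the mean. The weights differ from 1 by at most 2 |t| B, which controls the first
  term; \<open>mu_tilt_diff\<close> controls the second.\<close>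

lemma sig2_tilt_diff: "\<bar>sig2 S' d x - sig2 S d x\<bar> \<le> 2 * \<bar>t\<bar> * B * Chi + (2 * \<bar>t\<bar> * drift_bound)\<^sup>2"
proof -
  let ?m = "mu S d x" and ?m' = "mu S' d x"
  let ?E = "\<lambda>f. \<integral>p. w d x (arm d p) * f (arm d p) \<partial>ky S x"
  have i1: "integrable (ky S x) (\<lambda>p. w d x (arm d p) * (arm d p - ?m)\<^sup>2)"
    by (intro integrable_w_mult integrable_arm_centered)
  have i2: "integrable (ky S x) (\<lambda>p. w d x (arm d p) * (arm d p - ?m))"
    using integrable_arm by (intro integrable_w_mult) auto
  have i3: "integrable (ky S x) (\<lambda>p. w d x (arm d p))"
    using integrable_w_mult[of x "\<lambda>_. 1" d] by simp
  have e3: "(\<integral>p. w d x (arm d p) \<partial>ky S x) = 1"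
    using integral_w_mult[of x "\<lambda>_. 1" d] b_mean[where d=d and x=x] by simp
  have e2: "?E (\<lambda>y. y - ?m) = ?m' - ?m"
  proof -
    have "?E (\<lambda>y. y - ?m) = ?E (\<lambda>y. y) - ?m"
      using integrable_w_mult[OF integrable_arm, where d=d and x=x] i3 e3 by (simp add: right_diff_distrib)
    also have "?E (\<lambda>y. y) = ?m'"
      unfolding mu_arm[of S'] using integral_ky_tilt(1)[of "\<lambda>y. y", where d=d and x=x] by simp
    finally show ?thesis .
  qed
  have "sig2 S' d x = ?E (\<lambda>y. (y - ?m')\<^sup>2)"
    unfolding sig2_arm[of S'] by (rule integral_ky_tilt(1)) measurable
  also have "\<dots> = (\<integral>p. w d x (arm d p) * (arm d p - ?m)\<^sup>2 - 2 * (?m' - ?m) * (w d x (arm d p) * (arm d p - ?m))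
        + (?m' - ?m)\<^sup>2 * w d x (arm d p) \<partial>ky S x)"
    by (intro Bochner_Integration.integral_cong) (auto simp: power2_eq_square algebra_simps)
  also have "\<dots> = ?E (\<lambda>y. (y - ?m)\<^sup>2) - (?m' - ?m)\<^sup>2"
    using i1 i2 i3 by (simp add: e2 e3 power2_eq_square)
  finally have s: "sig2 S' d x = ?E (\<lambda>y. (y - ?m)\<^sup>2) - (?m' - ?m)\<^sup>2" .
  have "\<bar>?E (\<lambda>y. (y - ?m)\<^sup>2) - sig2 S d x\<bar> \<le> 2 * \<bar>t\<bar> * B * Chi"
  proof -
    have "?E (\<lambda>y. (y - ?m)\<^sup>2) - sig2 S d x = (\<integral>p. (w d x (arm d p) - 1) * (arm d p - ?m)\<^sup>2 \<partial>ky S x)"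
      using i1 integrable_arm_centered[of x d ?m] by (simp add: sig2_arm left_diff_distrib)
    also have "\<bar>\<dots>\<bar> \<le> (\<integral>p. \<bar>(w d x (arm d p) - 1) * (arm d p - ?m)\<^sup>2\<bar> \<partial>ky S x)"
      by (rule integral_abs_bound)
    also have "\<dots> \<le> (\<integral>p. 2 * \<bar>t\<bar> * B * (arm d p - ?m)\<^sup>2 \<partial>ky S x)"
    proof (rule integral_mono)
      show "integrable (ky S x) (\<lambda>p. \<bar>(w d x (arm d p) - 1) * (arm d p - ?m)\<^sup>2\<bar>)"
        using i1 integrable_arm_centered[of x d ?m] by (simp add: left_diff_distrib)
      fix p show "\<bar>(w d x (arm d p) - 1) * (arm d p - ?m)\<^sup>2\<bar> \<le> 2 * \<bar>t\<bar> * B * (arm d p - ?m)\<^sup>2"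
        unfolding abs_mult using tb_quot(1)[of d x "arm d p"]
        using B_nonneg by (intro mult_mono) (auto simp: tilt_weight_def)
    qed (use integrable_arm_centered[of x d ?m] in auto)
    also have "\<dots> = 2 * \<bar>t\<bar> * B * sig2 S d x" by (simp add: sig2_arm)
    also have "\<dots> \<le> 2 * \<bar>t\<bar> * B * Chi"
      using sig2_bounds(2)[of d x] B_nonneg by (intro mult_left_mono) auto
    finally show ?thesis .
  qed
  moreover have "(?m' - ?m)\<^sup>2 \<le> (2 * \<bar>t\<bar> * drift_bound)\<^sup>2"
    using mu_tilt_diff[of d x] order_trans[OF abs_ge_zero mu_tilt_diff[of d x]]
    by (intro power2_le_iff_abs_le[THEN iffD2])
  ultimately show ?thesis unfolding s using zero_le_power2[of "?m' - ?m"] by linarith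
qed

lemma in_model_tilt: "in_model Clo Chi eps S'"
proof -
  interpret T: dgp_kernel S' by (rule dgp_kernel_tilt)
  have K: "0 \<le> drift_bound" using drift_le[of True undefined] by linarith
  have t2: "t\<^sup>2 \<le> \<bar>t\<bar>"
    using t_margin(1) mult_left_mono[of "\<bar>t\<bar>" 1 "\<bar>t\<bar>"] by (simp add: power2_eq_square)
  have m1: "2 * \<bar>t\<bar> * drift_bound < \<eta>" and m2: "2 * \<bar>t\<bar> * B * Chi + (2 * \<bar>t\<bar> * drift_bound)\<^sup>2 < \<eta>"
  proof -
    have p: "0 \<le> \<bar>t\<bar> * (2 * B * Chi)" "0 \<le> \<bar>t\<bar> * (4 * drift_bound\<^sup>2)" "0 \<le> \<bar>t\<bar> * (2 * drift_bound)"
      using B_nonneg Chi_pos K by auto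
    have q: "\<bar>t\<bar> * (2 * B * Chi) + \<bar>t\<bar> * (4 * drift_bound\<^sup>2) + \<bar>t\<bar> * (2 * drift_bound) < \<eta>"
      using t_margin(2) by (simp add: distrib_left)
    have "(2 * \<bar>t\<bar> * drift_bound)\<^sup>2 = t\<^sup>2 * (4 * drift_bound\<^sup>2)"
      by (simp add: power_mult_distrib)
    also have "\<dots> \<le> \<bar>t\<bar> * (4 * drift_bound\<^sup>2)"
      using t2 by (intro mult_right_mono) auto
    finally have r: "(2 * \<bar>t\<bar> * drift_bound)\<^sup>2 \<le> \<bar>t\<bar> * (4 * drift_bound\<^sup>2)" .
    have "2 * \<bar>t\<bar> * drift_bound = \<bar>t\<bar> * (2 * drift_bound)" "2 * \<bar>t\<bar> * B * Chi = \<bar>t\<bar> * (2 * B * Chi)" by simp_all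
    then show "2 * \<bar>t\<bar> * drift_bound < \<eta>" "2 * \<bar>t\<bar> * B * Chi + (2 * \<bar>t\<bar> * drift_bound)\<^sup>2 < \<eta>"
      using p q r by linarith+
  qed
  \<comment> \<open>Where \<open>b\<close> vanishes in both arms the weights are 1 and nothing
    moves; elsewhere the margin \<eta> exceeds the displacement of either moment.\<close>
  have moments: "\<bar>mu S' d x\<bar> < Chi \<and> Clo < sig2 S' d x \<and> sig2 S' d x < Chi" for d x
  proof (cases "\<forall>d' y. b d' x y = 0")
    case True
    have "w d' x y = 1" for d' y using True by (simp add: tilt_weight_def)
    then have "mu S' d x = mu S d x"
      unfolding mu_arm using integral_ky_tilt(1)[of "\<lambda>y. y", where d=d and x=x] by simp
    moreover from this have "sig2 S' d x = sig2 S d x"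
      unfolding sig2_arm using integral_ky_tilt(1)[of "\<lambda>y. (y - mu S d x)\<^sup>2", where d=d and x=x]
      by (simp add: \<open>\<And>d' y. w d' x y = 1\<close>)
    ultimately show ?thesis using mu_bound sig2_bounds by simp
  next
    case False
    then obtain d' y where "b d' x y \<noteq> 0" by blast
    from margin[OF this, of d] show ?thesis
      using mu_tilt_diff[of d x] sig2_tilt_diff[of d x] m1 m2 by linarith
  qed
  \<comment> \<open>Null sets of \<open>px S\<close> stay null after reweighting and the
    propensities are untouched, so overlap and absolute continuity carry over.\<close>
  have ac: "absolutely_continuous (px S) (px S')"
    unfolding px_tilt by (rule absolutely_continuousI_density) measurable
  have sq: "integrable (ky S' x) (\<lambda>p. (fst p)\<^sup>2)" "integrable (ky S' x) (\<lambda>p. (snd p)\<^sup>2)" for x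
    using integral_ky_tilt(2)[of "\<lambda>y. y\<^sup>2", where d=True and x=x] integral_ky_tilt(2)[of "\<lambda>y. y\<^sup>2", where d=False and x=x]
      integrable_arm_sq[of x True] integrable_arm_sq[of x False] by (auto simp: arm_def)
  have AE0: "AE x in px S. \<forall>d. eps < gprop S d x \<and> gprop S d x \<le> 1 - eps"
    using model unfolding in_model_def by blast
  have AE: "AE x in px S'. \<forall>d. eps < gprop S' d x \<and> gprop S' d x \<le> 1 - eps"
    unfolding gprop_tilt by (rule absolutely_continuous_AE[OF _ ac AE0]) (simp add: px_tilt)
  have "absolutely_continuous lborel (px S)"
    using model unfolding in_model_def by blast
  then have ac': "absolutely_continuous lborel (px S')"
    using ac unfolding absolutely_continuous_def by (rule order_trans)
  show ?thesis
    unfolding in_model_def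
    by (intro conjI allI T.px_prob T.sets_px ac' T.pi1_meas T.e1_meas T.bounds T.ky_meas sq AE)
      (simp_all add: moments)
qed

text \<open>The covariate density 1 + t a cancels the denominators in \<open>mu_tilt\<close>, so
  \<open>tau\<close> is exactly affine in t and the shift in the limit experiment has no
  remainder.\<close>

lemma tau_tilt: "tau S' = tau S + t * tau_deriv"
proof -
  interpret T: dgp_kernel S' by (rule dgp_kernel_tilt)
  have i1: "integrable (px S) (cate S)"
    by (rule integrable_px_bounded[OF _ cate_bound]) measurable
  have i2: "integrable (px S) (\<lambda>x. a x * cate S x + (drift True x - drift False x))"
  proof (rule integrable_px_bounded)
    fix x
    have "\<bar>a x * cate S x\<bar> \<le> B * (2 * Chi)"
      unfolding abs_mult by (intro mult_mono a_bound cate_bound B_nonneg) auto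
    then show "\<bar>a x * cate S x + (drift True x - drift False x)\<bar> \<le> B * (2 * Chi) + 2 * drift_bound"
      using drift_le[of True x] drift_le[of False x] by linarith
  qed measurable
  have "tau S' = (\<integral>x. (1 + t * a x) * cate S' x \<partial>px S)"
    unfolding tau_def px_tilt by (subst integral_real_density) (auto simp: ta_pos)
  also have "\<dots> = (\<integral>x. cate S x + t * (a x * cate S x + (drift True x - drift False x)) \<partial>px S)"
  proof (intro Bochner_Integration.integral_cong refl)
    fix x
    have *: "c * (m + t / c * u) = c * m + t * u" if "c \<noteq> 0" for c m u :: real
      using that by (simp add: distrib_left)
    have "(1 + t * a x) * cate S' x = (1 + t * a x) * mu S' True x - (1 + t * a x) * mu S' False x"
      by (simp add: cate_def right_diff_distrib)
    also have "\<dots> = ((1 + t * a x) * mu S True x + t * drift True x) - ((1 + t * a x) * mu S False x + t * drift False x)"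
      using ta_pos(2)[of x] by (simp only: mu_tilt) (subst *, simp, subst *, simp, rule refl)
    also have "\<dots> = cate S x + t * (a x * cate S x + (drift True x - drift False x))"
      by (simp add: cate_def algebra_simps)
    finally show "(1 + t * a x) * cate S' x = cate S x + t * (a x * cate S x + (drift True x - drift False x))" .
  qed
  also have "\<dots> = tau S + t * tau_deriv"
    using i1 i2 by (simp add: tau_def tau_deriv_def)
  finally show ?thesis .
qed

end

section \<open>Quadratic mean differentiability and the bound along a path\<close>

text \<open>Multiplying by the conjugate, (r - 1 - u/2) (r + 1 + u/2) = - u^2 / 4 for r = sqrt (1 +
  u), and the second factor is at least 1/2.\<close>

lemma sqrt_linearization_bound:
  fixes u :: real
  assumes "\<bar>u\<bar> \<le> 1 / 2"
  shows "(sqrt (1 + u) - 1 - u / 2)\<^sup>2 \<le> u ^ 4"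
proof -
  define r where "r = sqrt (1 + u)"
  have r: "r\<^sup>2 = 1 + u" "0 \<le> r" using assms by (auto simp: r_def)
  have den: "1 / 2 \<le> r + (1 + u / 2)" using r(2) assms by linarith
  have "(r - 1 - u / 2) * (r + (1 + u / 2)) = - u\<^sup>2 / 4"
    using r(1) by (simp add: power2_eq_square algebra_simps)
  moreover have "\<bar>r - 1 - u / 2\<bar> * (r + (1 + u / 2)) = \<bar>(r - 1 - u / 2) * (r + (1 + u / 2))\<bar>"
    unfolding abs_mult using den by simp
  ultimately have "\<bar>r - 1 - u / 2\<bar> * (r + (1 + u / 2)) = u\<^sup>2 / 4" by simp
  moreover have "\<bar>r - 1 - u / 2\<bar> * (1 / 2) \<le> \<bar>r - 1 - u / 2\<bar> * (r + (1 + u / 2))"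
    using den by (intro mult_left_mono) auto
  moreover have "v \<le> u\<^sup>2" if "v * y = u\<^sup>2 / 4" "v * (1 / 2) \<le> v * y" for v y
    using that zero_le_power2[of u] by linarith
  ultimately have "\<bar>r - 1 - u / 2\<bar> \<le> u\<^sup>2" by blast
  then have "(r - 1 - u / 2)\<^sup>2 \<le> (u\<^sup>2)\<^sup>2"
    by (intro power2_le_iff_abs_le[THEN iffD2]) auto
  then show ?thesis by (simp add: r_def)
qed

text \<open>\<open>P\<close> itself serves as dominating measure, with densities 1 + t s. The
  squared remainder is at most (t s)^4, so division by t^2 leaves t^2 B^4, which tends to 0.\<close>

lemma qmd_path_linear:
  assumes P: "prob_space P" "sets P = sets M" and s: "s \<in> borel_measurable M"
    and sB: "\<And>z. \<bar>s z\<bar> \<le> B" and "0 < \<delta>"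
    and Q: "\<And>t. \<bar>t\<bar> < \<delta> \<Longrightarrow> Q t = density P (\<lambda>z. ennreal (1 + t * s z))"
  shows "qmd_path M Q"
proof -
  interpret P: prob_space P by fact
  have B: "0 \<le> B" using sB[of undefined] by linarith
  \<comment> \<open>Chosen so that |t s| \<le> 1/2; the added 1 covers B = 0.\<close>
  define \<delta>' where "\<delta>' = min \<delta> (1 / (2 * B + 1))"
  have \<delta>': "0 < \<delta>'" "\<delta>' \<le> \<delta>" using \<open>0 < \<delta>\<close> B by (auto simp: \<delta>'_def)
  have ts: "\<bar>t * s z\<bar> \<le> 1 / 2" if "\<bar>t\<bar> < \<delta>'" for t z
  proof -
    have "\<bar>t * s z\<bar> \<le> \<delta>' * B"
      unfolding abs_mult using that sB B by (intro mult_mono) auto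
    also have "\<dots> \<le> 1 / (2 * B + 1) * B" using B by (intro mult_right_mono) (auto simp: \<delta>'_def)
    also have "\<dots> \<le> 1 / 2" using B by (simp add: field_simps)
    finally show ?thesis .
  qed
  define q where "q t z = 1 + t * s z" for t z
  have lim: "((\<lambda>t. \<integral>\<^sup>+z. ennreal ((sqrt (q t z) - sqrt (q 0 z) - t / 2 * s z * sqrt (q 0 z))\<^sup>2 / t\<^sup>2) \<partial>P) \<longlongrightarrow> 0) (at 0)"
  proof (rule tendsto_sandwich[OF _ _ tendsto_const])
    show "((\<lambda>t. ennreal (t\<^sup>2 * B ^ 4)) \<longlongrightarrow> 0) (at 0)"
    proof -
      have "((\<lambda>t. ennreal (t\<^sup>2 * B ^ 4)) \<longlongrightarrow> ennreal (0\<^sup>2 * B ^ 4)) (at 0)"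
        by (intro tendsto_ennrealI tendsto_intros)
      then show ?thesis by simp
    qed
    have "\<forall>\<^sub>F t in at 0. \<bar>t\<bar> < \<delta>' \<and> t \<noteq> 0"
      using \<delta>'(1) by (auto simp: eventually_at dist_real_def intro!: exI[of _ \<delta>'])
    then show "\<forall>\<^sub>F t in at 0. (\<integral>\<^sup>+z. ennreal ((sqrt (q t z) - sqrt (q 0 z) - t / 2 * s z * sqrt (q 0 z))\<^sup>2 / t\<^sup>2) \<partial>P)
        \<le> ennreal (t\<^sup>2 * B ^ 4)"
    proof eventually_elim
      case (elim t)
      have "(\<integral>\<^sup>+z. ennreal ((sqrt (q t z) - sqrt (q 0 z) - t / 2 * s z * sqrt (q 0 z))\<^sup>2 / t\<^sup>2) \<partial>P)
          \<le> (\<integral>\<^sup>+z. ennreal (t\<^sup>2 * B ^ 4) \<partial>P)"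
      proof (intro nn_integral_mono ennreal_leI)
        fix z
        have "(sqrt (q t z) - sqrt (q 0 z) - t / 2 * s z * sqrt (q 0 z))\<^sup>2 / t\<^sup>2
            = (sqrt (1 + t * s z) - 1 - t * s z / 2)\<^sup>2 / t\<^sup>2" by (simp add: q_def)
        also have "\<dots> \<le> (t * s z) ^ 4 / t\<^sup>2"
          using sqrt_linearization_bound ts elim by (intro divide_right_mono) auto
        also have "\<dots> = t\<^sup>2 * \<bar>s z\<bar> ^ 4"
          using elim by (simp add: power_mult_distrib field_simps eval_nat_numeral)
        also have "\<dots> \<le> t\<^sup>2 * B ^ 4"
          using sB by (intro mult_left_mono power_mono) auto
        finally show "(sqrt (q t z) - sqrt (q 0 z) - t / 2 * s z * sqrt (q 0 z))\<^sup>2 / t\<^sup>2 \<le> t\<^sup>2 * B ^ 4" .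
      qed
      then show ?case by (simp add: P.emeasure_space_1)
    qed
  qed auto
  have qs: "q t \<in> borel_measurable M \<and> (\<forall>z. 0 \<le> q t z) \<and> Q t = density P (\<lambda>z. ennreal (q t z))" if "\<bar>t\<bar> < \<delta>'" for t
  proof (intro conjI allI)
    show "q t \<in> borel_measurable M" unfolding q_def using s by measurable
    show "0 \<le> q t z" for z using ts[OF that, of z] unfolding q_def by linarith
    show "Q t = density P (\<lambda>z. ennreal (q t z))" unfolding q_def using Q that \<delta>'(2) by simp
  qed
  show ?thesis
    unfolding qmd_path_def
    by (intro exI[of _ P] exI[of _ q] exI[of _ s] exI[of _ \<delta>'] conjI allI impI)
      (use P \<delta>' s lim qs P.sigma_finite_measure_axioms in auto)
qed

context score_direction
begin

text \<open>For one small t > 0 the tilted observed law is a probability measure with density 1 + t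
  times the score, and total mass 1 forces mean 0. The density formula thus replaces a
  disintegration of a signed integral.\<close>

lemma score_mean: "(\<integral>z. score a b z \<partial>obs_law S) = 0"
proof -
  interpret M: prob_space "obs_law S" by (rule prob_space_obs_law)
  define t where "t = 1 / (4 * B + 1)"
  have t: "0 < t" "\<bar>t\<bar> * (4 * B) \<le> 1" using B_nonneg by (auto simp: t_def field_simps)
  interpret small_tilt S a b B t by unfold_locales (rule t(2))
  interpret T: dgp_kernel S' by (rule dgp_kernel_tilt)
  interpret Q: prob_space "obs_law S'" by (rule T.prob_space_obs_law)
  have i: "integrable (obs_law S) (score a b)"
    using score_bound by (intro M.integrable_const_bound[of _ "2 * B"]) auto
  have nn: "0 \<le> 1 + t * score a b z" for z
  proof -
    have "\<bar>t * score a b z\<bar> \<le> \<bar>t\<bar> * (2 * B)"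
      by (simp add: abs_mult mult_left_mono score_bound)
    also have "\<dots> \<le> 1" using t B_nonneg by (simp add: mult.left_commute)
    finally show ?thesis by linarith
  qed
  have "1 = emeasure (obs_law S') (space (obs_law S'))" by (simp add: Q.emeasure_space_1)
  also have "\<dots> = (\<integral>\<^sup>+z. ennreal (1 + t * score a b z) \<partial>obs_law S)"
    unfolding obs_law_tilt
    by (subst emeasure_density) (auto intro!: nn_integral_cong simp: sets_eq_imp_space_eq[OF sets_obs_law])
  also have "\<dots> = ennreal (\<integral>z. 1 + t * score a b z \<partial>obs_law S)"
    using i nn by (intro nn_integral_eq_integral) auto
  also have "(\<integral>z. 1 + t * score a b z \<partial>obs_law S) = 1 + t * (\<integral>z. score a b z \<partial>obs_law S)"
    using i M.prob_space by simp
  finally show ?thesis using t(1) by (simp add: ennreal_eq_1)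
qed

end

context model_direction
begin

lemma regular_estimator_exp_bound:
  assumes reg: "regular_estimator Clo Chi eps S T L" and L2: "integrable L (\<lambda>x. x\<^sup>2)"
  shows "tau_deriv\<^sup>2 \<le> (exp (\<integral>z. (score a b z)\<^sup>2 \<partial>obs_law S) - 1) * (\<integral>x. x\<^sup>2 \<partial>L)"
proof -
  define K where "K = 2 * B * Chi + 4 * drift_bound\<^sup>2 + 2 * drift_bound"
  have "0 \<le> drift_bound" using drift_le[of True undefined] by linarith
  then have K: "0 \<le> K" using B_nonneg Chi_pos by (simp add: K_def)
  \<comment> \<open>The terms secure |t| \<le> 1, the smallness condition of
    \<open>small_tilt\<close>, and the margin; the added 1 keeps the denominators positive and makes
    the margin inequality strict.\<close>
  define \<delta> where "\<delta> = min (min 1 (1 / (4 * B + 1))) (\<eta> / (K + 1))"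
  have \<delta>: "0 < \<delta>" using B_nonneg K margin_pos by (simp add: \<delta>_def)
  have tilt: "model_tilt S Clo Chi eps a b B \<eta> t" if "\<bar>t\<bar> < \<delta>" for t
  proof unfold_locales
    have "\<bar>t\<bar> * (4 * B) \<le> 1 / (4 * B + 1) * (4 * B)"
      using that B_nonneg by (intro mult_right_mono) (auto simp: \<delta>_def)
    also have "\<dots> \<le> 1" using B_nonneg by (simp add: field_simps)
    finally show "\<bar>t\<bar> * (4 * B) \<le> 1" .
    show "\<bar>t\<bar> \<le> 1" using that by (simp add: \<delta>_def)
    have "\<bar>t\<bar> * K \<le> \<eta> / (K + 1) * K" using that K by (intro mult_right_mono) (auto simp: \<delta>_def)
    also have "\<dots> < \<eta>" using K margin_pos by (simp add: field_simps)
    finally show "\<bar>t\<bar> * (2 * B * Chi + 4 * drift_bound\<^sup>2 + 2 * drift_bound) < \<eta>" by (simp add: K_def)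
  qed
  interpret M: prob_space "obs_law S" by (rule prob_space_obs_law)
  \<comment> \<open>At t = 0 the tilt would still replace the coupling of the potential outcomes by
    a product, so F 0 = S has to be imposed; from \<delta> on, the path is S in order to remain in
    the model.\<close>
  define F where "F t = (if t = 0 \<or> \<delta> \<le> \<bar>t\<bar> then S else tilt S a b t)" for t
  have F0: "F 0 = S" by (simp add: F_def)
  have F_model: "in_model Clo Chi eps (F t)" for t
    using model_tilt.in_model_tilt[OF tilt] model by (auto simp: F_def)
  have F_obs: "obs_law (F t) = density (obs_law S) (\<lambda>z. ennreal (1 + t * score a b z))" if "\<bar>t\<bar> < \<delta>" for t
    using that small_tilt.obs_law_tilt[OF model_tilt.axioms(2)[OF tilt]]
    by (auto simp: F_def density_1[symmetric])
  have F_tau: "tau (F t) = tau S + t * tau_deriv" if "\<bar>t\<bar> < \<delta>" for t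
    using that model_tilt.tau_tilt[OF tilt] by (auto simp: F_def)
  have F_qmd: "qmd_path Mobs (\<lambda>t. obs_law (F t))"
    by (rule qmd_path_linear[OF M.prob_space_axioms sets_obs_law score_meas score_bound \<delta>]) (rule F_obs)
  \<comment> \<open>The constant path is admissible as well and supplies the convergence to L under
    the original law.\<close>
  have S_qmd: "qmd_path Mobs (\<lambda>t. obs_law S)"
    by (rule qmd_path_linear[OF M.prob_space_axioms sets_obs_law, of "\<lambda>_. 0" 0 1]) (auto simp: density_1)
  have L: "real_distribution L" and T: "\<And>n. T n \<in> borel_measurable (PiM {..<n} (\<lambda>_. Mobs))"
    using reg unfolding regular_estimator_def by blast+
  have wc: "\<And>G :: real \<Rightarrow> 'x dgp. G 0 = S \<Longrightarrow> (\<And>t. in_model Clo Chi eps (G t)) \<Longrightarrow> qmd_path Mobs (\<lambda>t. obs_law (G t)) \<Longrightarrow>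
        weak_conv_m (\<lambda>n. distr (PiM {..<n} (\<lambda>_. obs_law (G (1 / sqrt (real n))))) borel
                        (\<lambda>\<omega>. sqrt (real n) * (T n \<omega> - tau (G (1 / sqrt (real n)))))) L"
    using reg[unfolded regular_estimator_def, THEN conjunct2, THEN conjunct2, rule_format] zero_less_one by blast
  have T': "T n \<in> borel_measurable (PiM {..<n} (\<lambda>_. obs_law S))" for n
  proof -
    have "sets (PiM {..<n} (\<lambda>_. obs_law S)) = sets (PiM {..<n} (\<lambda>_. Mobs))"
      by (rule sets_PiM_cong) auto
    then show ?thesis using T[of n] measurable_cong_sets by blast
  qed
  have ev: "\<forall>\<^sub>F n in sequentially. \<bar>1 / sqrt (real n)\<bar> < \<delta>"
  proof -
    obtain N :: nat where N: "(1 / \<delta>)\<^sup>2 < N" using reals_Archimedean2 by blast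
    show ?thesis using eventually_ge_at_top[of N]
    proof eventually_elim
      case (elim n)
      then have "(1 / \<delta>)\<^sup>2 < real n" using N by linarith
      then have "1 / \<delta> < sqrt (real n)" by (rule real_less_rsqrt)
      moreover from this have "0 < sqrt (real n)" using \<delta> by (meson divide_pos_pos less_trans zero_less_one)
      ultimately show ?case using \<delta> by (simp add: field_simps)
    qed
  qed
  show ?thesis
  proof (rule regular_shift_bound[where M="obs_law S" and s="score a b" and B="2 * B" and T=T and \<theta>'="tau S"
        and P="\<lambda>n. obs_law (F (1 / sqrt (real n)))" and \<theta>="\<lambda>n. tau (F (1 / sqrt (real n)))" and L=L])
    show "score a b \<in> borel_measurable (obs_law S)" by measurable
    show "weak_conv_m (\<lambda>n. distr (PiM {..<n} (\<lambda>_. obs_law S)) borel (\<lambda>\<omega>. sqrt (real n) * (T n \<omega> - tau S))) L"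
      by (rule wc[of "\<lambda>_. S"]) (auto simp: model S_qmd)
    show "weak_conv_m (\<lambda>n. distr (PiM {..<n} (\<lambda>_. obs_law (F (1 / sqrt (real n))))) borel
        (\<lambda>\<omega>. sqrt (real n) * (T n \<omega> - tau (F (1 / sqrt (real n)))))) L"
      by (rule wc[of F, OF F0 F_model F_qmd])
    show "prob_space (obs_law (F (1 / sqrt (real n))))" for n
      by (rule dgp_kernel.prob_space_obs_law[OF in_model_dgp_kernel[OF F_model]])
    show "\<forall>\<^sub>F n in sequentially. obs_law (F (1 / sqrt (real n))) = density (obs_law S) (\<lambda>z. ennreal (1 + 1 / sqrt (real n) * score a b z))"
      using ev by eventually_elim (rule F_obs)
    show "\<forall>\<^sub>F n in sequentially. tau (F (1 / sqrt (real n))) = tau S + 1 / sqrt (real n) * tau_deriv"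
      using ev by eventually_elim (rule F_tau)
  qed (use M.prob_space_axioms score_bound score_mean L L2 T' in auto)
qed

end

text \<open>For 0 \<le> v \<le> 1, exp v - 1 \<le> v + v^2. With v = u J, dividing by u and letting
  u = 1 / (n + 1) tend to 0 leaves only the linear term.\<close>

lemma exp_bound_imp_linear_bound:
  fixes k J M :: real
  assumes J: "0 \<le> J" and M: "0 \<le> M" and le: "\<And>u. 0 < u \<Longrightarrow> u * k \<le> (exp (u * J) - 1) * M"
  shows "k \<le> J * M"
proof -
  have "(\<lambda>n. (J + inverse (real (Suc n)) * J\<^sup>2) * M) \<longlonglongrightarrow> (J + 0 * J\<^sup>2) * M"
    by (intro tendsto_intros LIMSEQ_inverse_real_of_nat)
  moreover obtain N :: nat where N: "J \<le> N" using real_arch_simple by blast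
  have "\<forall>\<^sub>F n in sequentially. k \<le> (J + inverse (real (Suc n)) * J\<^sup>2) * M"
    using eventually_ge_at_top[of N]
  proof eventually_elim
    case (elim n)
    define u where "u = inverse (real (Suc n))"
    have u: "0 < u" by (simp add: u_def)
    have "J \<le> real (Suc n)" using N elim by simp
    then have uJ: "u * J \<le> 1" by (simp add: u_def field_simps)
    have "u * k \<le> (exp (u * J) - 1) * M" by (rule le[OF u])
    also have "\<dots> \<le> (u * J + (u * J)\<^sup>2) * M"
      using exp_bound[of "u * J"] u J uJ M by (intro mult_right_mono) auto
    also have "\<dots> = u * ((J + u * J\<^sup>2) * M)" by (simp add: power2_eq_square algebra_simps)
    finally have "k \<le> (J + u * J\<^sup>2) * M" using u by simp
    then show ?case unfolding u_def .
  qed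
  ultimately have "k \<le> (J + 0 * J\<^sup>2) * M"
    by (intro tendsto_lowerbound[OF _ _ sequentially_bot])
  then show ?thesis by simp
qed

text \<open>Directions may be scaled: a factor c = sqrt u multiplies the slope of \<open>tau\<close>
  by c and the information by u, with the same margin. Small scalings remove the loss in the
  exponential and leave the Cramer-Rao form.\<close>

lemma (in model_direction) regular_estimator_information_bound:
  assumes reg: "regular_estimator Clo Chi eps S T L" and L2: "integrable L (\<lambda>x. x\<^sup>2)"
  shows "tau_deriv\<^sup>2 \<le> (\<integral>z. (score a b z)\<^sup>2 \<partial>obs_law S) * (\<integral>x. x\<^sup>2 \<partial>L)"
proof (rule exp_bound_imp_linear_bound)
  fix u :: real assume u: "0 < u"
  define c where "c = sqrt u"
  have c: "0 < c" "c\<^sup>2 = u" using u by (auto simp: c_def)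
  interpret D: model_direction S Clo Chi eps "\<lambda>x. c * a x" "\<lambda>d x y. c * b d x y" "c * B" \<eta>
  proof unfold_locales
    show "(\<lambda>(x, y). c * b d x y) \<in> borel_measurable (borel \<Otimes>\<^sub>M borel)" for d by measurable
    show "\<bar>mu S d x\<bar> < Chi - \<eta> \<and> Clo + \<eta> < sig2 S d x \<and> sig2 S d x < Chi - \<eta>"
      if "c * b d' x y \<noteq> 0" for d d' x y using that margin[of d' x y d] by simp
  qed (use c a_bound b_bound a_mean b_mean margin_pos in \<open>auto simp: abs_mult\<close>)
  have dr: "D.drift d x = c * drift d x" for d x
    by (simp add: D.drift_def drift_def mult.assoc)
  have "D.tau_deriv = c * tau_deriv"
    unfolding D.tau_deriv_def tau_deriv_def dr
    by (subst integral_mult_right_zero[symmetric]) (simp add: algebra_simps)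
  moreover have "score (\<lambda>x. c * a x) (\<lambda>d x y. c * b d x y) z = c * score a b z" for z
    by (cases z) (auto simp: score_def algebra_simps)
  ultimately show "u * tau_deriv\<^sup>2 \<le> (exp (u * (\<integral>z. (score a b z)\<^sup>2 \<partial>obs_law S)) - 1) * (\<integral>x. x\<^sup>2 \<partial>L)"
    using D.regular_estimator_exp_bound[OF reg L2] by (simp add: power_mult_distrib c(2))
qed auto

section \<open>The efficient influence function and its second moment\<close>

context model_point
begin

lemma integrable_cate: "integrable (px S) (cate S)"
  by (rule integrable_px_bounded[OF _ cate_bound]) measurable

lemma tau_bound: "\<bar>tau S\<bar> \<le> 2 * Chi"
proof -
  interpret prob_space "px S" by (rule px_prob)
  have "\<bar>tau S\<bar> \<le> (\<integral>x. \<bar>cate S x\<bar> \<partial>px S)" unfolding tau_def by (rule integral_abs_bound)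
  also have "\<dots> \<le> (\<integral>x. 2 * Chi \<partial>px S)"
    by (rule integral_mono) (simp_all add: integrable_cate cate_bound)
  finally show ?thesis using prob_space by simp
qed

definition centered_cate :: "'x \<Rightarrow> real" where
  "centered_cate x = cate S x - tau S"

lemma centered_cate_measurable [measurable]: "centered_cate \<in> borel_measurable borel"
  unfolding centered_cate_def by measurable

lemma centered_cate_bound: "\<bar>centered_cate x\<bar> \<le> 4 * Chi"
  using cate_bound[of x] tau_bound by (auto simp: centered_cate_def)

lemma centered_cate_mean: "(\<integral>x. centered_cate x \<partial>px S) = 0"
proof -
  interpret prob_space "px S" by (rule px_prob)
  show ?thesis using integrable_cate prob_space by (simp add: centered_cate_def tau_def)
qed

definition arm_sign :: "bool \<Rightarrow> real" where
  "arm_sign d = (if d then 1 else -1)"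

text \<open>Exhibits the direction to be approximated: its covariate part is bounded, its outcome
  part is unbounded in y and so is no \<open>score_direction\<close> in general.\<close>

lemma psi_OS_eq_score:
  "psi_OS S z = score centered_cate (\<lambda>d x y. arm_sign d / gprop S d x * (y - mu S d x)) z"
  by (cases z) (auto simp: psi_OS_def S_OS_def score_def centered_cate_def cate_def arm_sign_def minus_divide_left)

lemma V_OS_eq:
  "V_OS S = (\<integral>x. sig2 S True x / gprop S True x + sig2 S False x / gprop S False x
      + (centered_cate x)\<^sup>2 \<partial>px S)"
proof -
  let ?b = "\<lambda>d x y. arm_sign d / gprop S d x * (y - mu S d x)"
  have m: "(\<lambda>(x, y). ?b d x y) \<in> borel_measurable (borel \<Otimes>\<^sub>M borel)" for d by measurable
  have sc: "score centered_cate ?b \<in> borel_measurable Mobs"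
    using m by (intro score_measurable) auto
  have sq: "(?b d x y)\<^sup>2 = (y - mu S d x)\<^sup>2 / (gprop S d x)\<^sup>2" for d x y
    by (simp add: power_mult_distrib power_divide arm_sign_def)
  \<comment> \<open>Where the propensity is 0 both sides are 0, since division by 0 yields 0;
    elsewhere the weight cancels one of the two factors in the denominator.\<close>
  have gb: "gprop S d x * (\<integral>p. (?b d x (arm d p))\<^sup>2 \<partial>ky S x) = sig2 S d x / gprop S d x" for d x
    unfolding sq by (simp add: sig2_arm[symmetric]) (simp add: power2_eq_square)
  have nn: "0 \<le> sig2 S d x / gprop S d x" for d x
    using sig2_bounds(1)[of d x] Clo_pos gprop_nonneg[of d x] by simp
  have "V_OS S = enn2real (\<integral>\<^sup>+z. ennreal ((score centered_cate ?b z)\<^sup>2) \<partial>obs_law S)"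
    unfolding V_OS_def psi_OS_eq_score using sc by (intro integral_eq_nn_integral) auto
  also have "(\<integral>\<^sup>+z. ennreal ((score centered_cate ?b z)\<^sup>2) \<partial>obs_law S)
     = (\<integral>\<^sup>+x. ennreal ((centered_cate x)\<^sup>2 + gprop S True x * (\<integral>p. (?b True x (arm True p))\<^sup>2 \<partial>ky S x)
         + gprop S False x * (\<integral>p. (?b False x (arm False p))\<^sup>2 \<partial>ky S x)) \<partial>px S)"
  proof (rule nn_integral_score_square)
    fix d x
    show "integrable (ky S x) (\<lambda>p. ?b d x (arm d p))" using integrable_arm by simp
    show "integrable (ky S x) (\<lambda>p. (?b d x (arm d p))\<^sup>2)" unfolding sq using integrable_arm_centered by simp
    show "(\<integral>p. ?b d x (arm d p) \<partial>ky S x) = 0" using integrable_arm[of x d] by (simp add: mu_arm)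
  qed (use m in auto)
  also have "\<dots> = (\<integral>\<^sup>+x. ennreal (sig2 S True x / gprop S True x + sig2 S False x / gprop S False x
      + (centered_cate x)\<^sup>2) \<partial>px S)"
    unfolding gb by (simp add: add_ac)
  also have "enn2real \<dots> = (\<integral>x. sig2 S True x / gprop S True x + sig2 S False x / gprop S False x
      + (centered_cate x)\<^sup>2 \<partial>px S)"
    using nn by (intro integral_eq_nn_integral[symmetric]) (auto intro!: add_nonneg_nonneg)
  finally show ?thesis .
qed

end

section \<open>Truncated efficient scores\<close>

text \<open>Zero beyond the level rather than clamped: then \<open>trunc k u * u\<close> is exactly
  the square of \<open>trunc k u\<close>, and slope and information share the quantity
  \<open>trunc_var\<close>.\<close>

definition trunc :: "nat \<Rightarrow> real \<Rightarrow> real" where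
  "trunc k u = (if \<bar>u\<bar> \<le> real k then u else 0)"

lemma trunc_measurable [measurable]: "trunc k \<in> borel_measurable borel"
  unfolding trunc_def by measurable

lemma trunc_bound: "\<bar>trunc k u\<bar> \<le> real k"
  by (simp add: trunc_def)

lemma trunc_mult_self: "trunc k u * u = (trunc k u)\<^sup>2"
  by (simp add: trunc_def power2_eq_square)

lemma trunc_sq_le: "(trunc k u)\<^sup>2 \<le> u\<^sup>2"
  by (simp add: trunc_def)

context model_point
begin

text \<open>The margin 1 / (k + 1) becomes \<eta> in \<open>model_direction\<close>. The lower
  propensity bound is included because overlap holds only almost surely, whereas scores must be
  bounded at every covariate.\<close>

definition well_inside :: "nat \<Rightarrow> 'x set" where
  "well_inside k = {x. \<forall>d. \<bar>mu S d x\<bar> < Chi - 1 / Suc k \<and> Clo + 1 / Suc k < sig2 S d x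
      \<and> sig2 S d x < Chi - 1 / Suc k \<and> eps < gprop S d x}"

lemma well_inside_sets [measurable]: "well_inside k \<in> sets borel"
proof -
  have "well_inside k = {x \<in> space borel. \<forall>d\<in>UNIV. \<bar>mu S d x\<bar> < Chi - 1 / Suc k \<and> Clo + 1 / Suc k < sig2 S d x
      \<and> sig2 S d x < Chi - 1 / Suc k \<and> eps < gprop S d x}"
    by (simp add: well_inside_def)
  also have "\<dots> \<in> sets borel" by measurable
  finally show ?thesis .
qed

lemma gprop_well_inside: "x \<in> well_inside k \<Longrightarrow> eps < gprop S d x"
  by (simp add: well_inside_def)

definition trunc_var :: "nat \<Rightarrow> bool \<Rightarrow> 'x \<Rightarrow> real" where
  "trunc_var k d x = (\<integral>p. (trunc k (arm d p - mu S d x))\<^sup>2 \<partial>ky S x)"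

definition trunc_mean :: "nat \<Rightarrow> bool \<Rightarrow> 'x \<Rightarrow> real" where
  "trunc_mean k d x = (\<integral>p. trunc k (arm d p - mu S d x) \<partial>ky S x)"

definition outcome_score :: "nat \<Rightarrow> bool \<Rightarrow> 'x \<Rightarrow> real \<Rightarrow> real" where
  "outcome_score k d x y = (if x \<in> well_inside k
     then arm_sign d / gprop S d x * (trunc k (y - mu S d x) - trunc_mean k d x) else 0)"

lemma trunc_var_measurable [measurable]: "trunc_var k d \<in> borel_measurable borel"
  unfolding trunc_var_def by measurable

lemma trunc_mean_measurable [measurable]: "trunc_mean k d \<in> borel_measurable borel"
  unfolding trunc_mean_def by measurable

lemma outcome_score_measurable [measurable]:
  "(\<lambda>(x, y). outcome_score k d x y) \<in> borel_measurable (borel \<Otimes>\<^sub>M borel)"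
  unfolding outcome_score_def by measurable

lemma integrable_bounded_ky:
  fixes f :: "real \<times> real \<Rightarrow> real"
  assumes "f \<in> borel_measurable borel" "\<And>p. \<bar>f p\<bar> \<le> K"
  shows "integrable (ky S x) f"
proof -
  interpret ky: prob_space "ky S x" by (rule ky_prob)
  show ?thesis using assms by (intro ky.integrable_const_bound[of _ K]) auto
qed

lemma integrable_trunc: "integrable (ky S x) (\<lambda>p. trunc k (arm d p - c))"
  by (rule integrable_bounded_ky[OF _ trunc_bound]) measurable

lemma integrable_trunc_sq: "integrable (ky S x) (\<lambda>p. (trunc k (arm d p - c))\<^sup>2)"
  by (rule Bochner_Integration.integrable_bound[OF integrable_arm_centered[of x d c]])
    (auto simp: trunc_sq_le)

lemma trunc_mean_bound: "\<bar>trunc_mean k d x\<bar> \<le> real k"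
proof -
  have "\<bar>trunc_mean k d x\<bar> \<le> (\<integral>p. \<bar>trunc k (arm d p - mu S d x)\<bar> \<partial>ky S x)"
    unfolding trunc_mean_def by (rule integral_abs_bound)
  also have "\<dots> \<le> (\<integral>p. real k \<partial>ky S x)"
    by (rule integral_mono) (simp_all add: integrable_trunc trunc_bound)
  finally show ?thesis by simp
qed

lemma trunc_var_bounds: "0 \<le> trunc_var k d x" "trunc_var k d x \<le> sig2 S d x"
  unfolding trunc_var_def sig2_arm
  by (simp, rule integral_mono) (simp_all add: integrable_trunc_sq integrable_arm_centered trunc_sq_le)

lemma trunc_var_tendsto: "(\<lambda>k. trunc_var k d x) \<longlonglongrightarrow> sig2 S d x"
  unfolding trunc_var_def sig2_arm
proof (rule integral_dominated_convergence[where w="\<lambda>p. (arm d p - mu S d x)\<^sup>2"])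
  show "AE p in ky S x. (\<lambda>k. (trunc k (arm d p - mu S d x))\<^sup>2) \<longlonglongrightarrow> (arm d p - mu S d x)\<^sup>2"
  proof (rule AE_I2)
    fix p
    obtain N :: nat where N: "\<bar>arm d p - mu S d x\<bar> \<le> N" using real_arch_simple by blast
    have "\<forall>\<^sub>F k in sequentially. (trunc k (arm d p - mu S d x))\<^sup>2 = (arm d p - mu S d x)\<^sup>2"
      using eventually_ge_at_top[of N]
    proof eventually_elim
      case (elim k)
      then have "\<bar>arm d p - mu S d x\<bar> \<le> real k" using N by linarith
      then show ?case by (simp add: trunc_def)
    qed
    then show "(\<lambda>k. (trunc k (arm d p - mu S d x))\<^sup>2) \<longlonglongrightarrow> (arm d p - mu S d x)\<^sup>2"
      by (rule tendsto_eventually)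
  qed
qed (auto simp: integrable_arm_centered trunc_sq_le)

lemma outcome_score_bound: "\<bar>outcome_score k d x y\<bar> \<le> 2 * real k / eps"
proof (cases "x \<in> well_inside k")
  case True
  then have g: "eps < gprop S d x" by (rule gprop_well_inside)
  have "\<bar>outcome_score k d x y\<bar> = \<bar>trunc k (y - mu S d x) - trunc_mean k d x\<bar> / gprop S d x"
    using True g eps_pos by (simp add: outcome_score_def arm_sign_def abs_mult)
  also have "\<dots> \<le> (2 * real k) / eps"
    using g eps_pos trunc_bound[of k "y - mu S d x"] trunc_mean_bound[of k d x]
    by (intro frac_le) auto
  finally show ?thesis .
qed (use eps_pos in \<open>simp add: outcome_score_def\<close>)

lemma outcome_score_mean: "(\<integral>p. outcome_score k d x (arm d p) \<partial>ky S x) = 0"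
  using integrable_trunc[of x k d "mu S d x"]
  by (cases "x \<in> well_inside k") (simp_all add: outcome_score_def trunc_mean_def)

text \<open>Split y into (y - m) + m with m the conditional mean. The first part gives
  \<open>trunc_var\<close>; the second gives m times \<open>trunc_mean\<close>, which the recentring
  term removes because y has mean m.\<close>

lemma integral_outcome_score_arm:
  "(\<integral>p. outcome_score k d x (arm d p) * arm d p \<partial>ky S x)
    = (if x \<in> well_inside k then arm_sign d * trunc_var k d x / gprop S d x else 0)"
proof (cases "x \<in> well_inside k")
  case True
  let ?c = "arm_sign d / gprop S d x" and ?m = "mu S d x"
  have e: "outcome_score k d x y * y = ?c * (trunc k (y - ?m))\<^sup>2 + ?c * ?m * trunc k (y - ?m)
      - ?c * trunc_mean k d x * y" for y
  proof -
    have "outcome_score k d x y * y = ?c * (trunc k (y - ?m) * (y - ?m)) + ?c * ?m * trunc k (y - ?m)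
        - ?c * trunc_mean k d x * y"
      using True by (simp add: outcome_score_def algebra_simps)
    then show ?thesis unfolding trunc_mult_self .
  qed
  show ?thesis unfolding e using True integrable_trunc[of x k d ?m] integrable_trunc_sq[of x k d ?m] integrable_arm[of x d]
    by (simp add: trunc_var_def[symmetric] trunc_mean_def[symmetric] mu_arm[symmetric])
qed (simp add: outcome_score_def)

text \<open>The truncated residual has variance \<open>trunc_var\<close> minus the square of
  \<open>trunc_mean\<close>, and that square is dropped. The right side is the contribution of arm d
  to the slope, so the information cannot exceed the slope.\<close>

lemma integral_outcome_score_sq:
  "gprop S d x * (\<integral>p. (outcome_score k d x (arm d p))\<^sup>2 \<partial>ky S x)
    \<le> (if x \<in> well_inside k then trunc_var k d x / gprop S d x else 0)"
proof (cases "x \<in> well_inside k")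
  case True
  let ?g = "gprop S d x" and ?m = "mu S d x" and ?t = "trunc_mean k d x"
  have g: "0 < ?g" using gprop_well_inside[OF True, of d] eps_pos by linarith
  have e: "(outcome_score k d x y)\<^sup>2 = inverse (?g\<^sup>2) * ((trunc k (y - ?m))\<^sup>2 - 2 * ?t * trunc k (y - ?m) + ?t\<^sup>2)" for y
  proof -
    have "(outcome_score k d x y)\<^sup>2 = inverse (?g\<^sup>2) * (trunc k (y - ?m) - ?t)\<^sup>2"
      using True by (simp add: outcome_score_def arm_sign_def power_mult_distrib power_divide divide_inverse power_inverse)
    also have "(trunc k (y - ?m) - ?t)\<^sup>2 = (trunc k (y - ?m))\<^sup>2 - 2 * ?t * trunc k (y - ?m) + ?t\<^sup>2"
      by (simp add: power2_diff)
    finally show ?thesis .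
  qed
  have "(\<integral>p. (outcome_score k d x (arm d p))\<^sup>2 \<partial>ky S x) = inverse (?g\<^sup>2) * (trunc_var k d x - ?t\<^sup>2)"
    unfolding e using integrable_trunc[of x k d ?m] integrable_trunc_sq[of x k d ?m]
    by (simp add: trunc_var_def[symmetric] trunc_mean_def[symmetric]) (simp add: power2_eq_square)
  then have "?g * (\<integral>p. (outcome_score k d x (arm d p))\<^sup>2 \<partial>ky S x) = (trunc_var k d x - ?t\<^sup>2) / ?g"
    using g by (simp add: field_simps power2_eq_square)
  also have "\<dots> \<le> trunc_var k d x / ?g" using g by (intro divide_right_mono) auto
  finally show ?thesis using True by simp
qed (simp add: outcome_score_def)

text \<open>Up to a multiple of \<open>centered_cate\<close>, the integrand of the slope along the
  k-th truncated score; also a pointwise upper bound for the integrand of its information.\<close>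

definition bound_integrand :: "nat \<Rightarrow> 'x \<Rightarrow> real" where
  "bound_integrand k x = (centered_cate x)\<^sup>2 + (if x \<in> well_inside k
     then trunc_var k True x / gprop S True x + trunc_var k False x / gprop S False x else 0)"

lemma bound_integrand_measurable [measurable]: "bound_integrand k \<in> borel_measurable borel"
  unfolding bound_integrand_def by measurable

lemma bound_integrand_nonneg: "0 \<le> bound_integrand k x"
  unfolding bound_integrand_def using trunc_var_bounds(1) gprop_nonneg by simp

lemma bound_integrand_le: "bound_integrand k x \<le> (4 * Chi)\<^sup>2 + 2 * Chi / eps"
proof -
  have sq: "(centered_cate x)\<^sup>2 \<le> (4 * Chi)\<^sup>2"
    using centered_cate_bound[of x] Chi_pos by (intro power2_le_iff_abs_le[THEN iffD2]) auto
  have *: "trunc_var k d x / gprop S d x \<le> Chi / eps" if "x \<in> well_inside k" for d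
    using trunc_var_bounds[of k d x] sig2_bounds(2)[of d x] gprop_well_inside[OF that, of d] eps_pos Chi_pos
    by (intro frac_le) auto
  have "2 * Chi / eps = Chi / eps + Chi / eps" by simp
  then have
    "(centered_cate x)\<^sup>2 + (trunc_var k True x / gprop S True x + trunc_var k False x / gprop S False x)
       \<le> (4 * Chi)\<^sup>2 + 2 * Chi / eps" if "x \<in> well_inside k"
    using sq *[OF that, of True] *[OF that, of False] by linarith
  moreover have "(centered_cate x)\<^sup>2 + 0 \<le> (4 * Chi)\<^sup>2 + 2 * Chi / eps"
    using sq Chi_pos eps_pos by (intro add_mono) auto
  ultimately show ?thesis unfolding bound_integrand_def by presburger
qed

lemma integrable_bound_integrand: "integrable (px S) (bound_integrand k)"
  using bound_integrand_nonneg bound_integrand_le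
  by (intro integrable_px_bounded[of _ "(4 * Chi)\<^sup>2 + 2 * Chi / eps"]) auto

text \<open>The slope equals \<kappa> and the information is at most \<kappa>, so the information
  bound reads \<kappa>^2 \<le> \<kappa> M, and a positive \<kappa> cancels.\<close>

lemma truncated_bound:
  assumes reg: "regular_estimator Clo Chi eps S T L" and L2: "integrable L (\<lambda>x. x\<^sup>2)"
  shows "(\<integral>x. bound_integrand k x \<partial>px S) \<le> (\<integral>x. x\<^sup>2 \<partial>L)"
proof -
  define B where "B = 4 * Chi + 2 * real k / eps"
  have B: "4 * Chi \<le> B" "2 * real k / eps \<le> B" using Chi_pos eps_pos by (auto simp: B_def)
  interpret D: model_direction S Clo Chi eps centered_cate "outcome_score k" B "1 / Suc k"
  proof unfold_locales
    show "\<bar>centered_cate x\<bar> \<le> B" for x using centered_cate_bound[of x] B by linarith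
    show "\<bar>outcome_score k d x y\<bar> \<le> B" for d x y using outcome_score_bound[of k d x y] B by linarith
    show "\<bar>mu S d x\<bar> < Chi - 1 / Suc k \<and> Clo + 1 / Suc k < sig2 S d x \<and> sig2 S d x < Chi - 1 / Suc k"
      if "outcome_score k d' x y \<noteq> 0" for d d' x y
    proof -
      have "x \<in> well_inside k" using that by (auto simp: outcome_score_def split: if_splits)
      then show ?thesis by (simp add: well_inside_def)
    qed
  qed (simp_all add: centered_cate_mean outcome_score_mean)
  define \<kappa> where "\<kappa> = (\<integral>x. bound_integrand k x \<partial>px S)"
  define M where "M = (\<integral>x. x\<^sup>2 \<partial>L)"
  have nn: "0 \<le> \<kappa>" "0 \<le> M" by (simp_all add: \<kappa>_def M_def bound_integrand_nonneg)
  have "D.tau_deriv = \<kappa>"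
  proof -
    \<comment> \<open>\<open>centered_cate\<close> times \<open>cate\<close> is the square of
      \<open>centered_cate\<close> plus \<open>tau S\<close> times \<open>centered_cate\<close>,
      which has mean 0; the arm signs turn the difference of drifts into a sum.\<close>
    have "D.tau_deriv = (\<integral>x. bound_integrand k x + tau S * centered_cate x \<partial>px S)"
      unfolding D.tau_deriv_def D.drift_def integral_outcome_score_arm
      by (intro Bochner_Integration.integral_cong)
        (auto simp: bound_integrand_def centered_cate_def arm_sign_def power2_eq_square algebra_simps)
    also have "\<dots> = \<kappa>"
      using integrable_bound_integrand[of k] D.integrable_a by (simp add: \<kappa>_def centered_cate_mean)
    finally show ?thesis .
  qed
  moreover have "(\<integral>z. (score centered_cate (outcome_score k) z)\<^sup>2 \<partial>obs_law S) \<le> \<kappa>"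
  proof -
    have "(\<integral>z. (score centered_cate (outcome_score k) z)\<^sup>2 \<partial>obs_law S)
       = enn2real (\<integral>\<^sup>+z. ennreal ((score centered_cate (outcome_score k) z)\<^sup>2) \<partial>obs_law S)"
      by (intro integral_eq_nn_integral) auto
    also have "\<dots> \<le> enn2real (ennreal \<kappa>)"
    proof (rule enn2real_mono)
      have "(\<integral>\<^sup>+z. ennreal ((score centered_cate (outcome_score k) z)\<^sup>2) \<partial>obs_law S)
        = (\<integral>\<^sup>+x. ennreal ((centered_cate x)\<^sup>2 + gprop S True x * (\<integral>p. (outcome_score k True x (arm True p))\<^sup>2 \<partial>ky S x)
         + gprop S False x * (\<integral>p. (outcome_score k False x (arm False p))\<^sup>2 \<partial>ky S x)) \<partial>px S)"
      proof (rule nn_integral_score_square)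
        show "integrable (ky S x) (\<lambda>p. (outcome_score k d x (arm d p))\<^sup>2)" for d x
          using D.integrable_b_mult[OF D.integrable_b] by (simp add: power2_eq_square)
      qed (use D.integrable_b outcome_score_mean in auto)
      also have "\<dots> \<le> (\<integral>\<^sup>+x. ennreal (bound_integrand k x) \<partial>px S)"
      proof (intro nn_integral_mono ennreal_leI)
        fix x
        show "(centered_cate x)\<^sup>2 + gprop S True x * (\<integral>p. (outcome_score k True x (arm True p))\<^sup>2 \<partial>ky S x)
         + gprop S False x * (\<integral>p. (outcome_score k False x (arm False p))\<^sup>2 \<partial>ky S x) \<le> bound_integrand k x"
          using integral_outcome_score_sq[of True x k] integral_outcome_score_sq[of False x k]
          by (simp add: bound_integrand_def split: if_splits)
      qed
      also have "\<dots> = ennreal \<kappa>" unfolding \<kappa>_def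
        using integrable_bound_integrand bound_integrand_nonneg by (intro nn_integral_eq_integral) auto
      finally show "(\<integral>\<^sup>+z. ennreal ((score centered_cate (outcome_score k) z)\<^sup>2) \<partial>obs_law S) \<le> ennreal \<kappa>" .
    qed simp
    finally show ?thesis using nn by simp
  qed
  ultimately have "\<kappa>\<^sup>2 \<le> \<kappa> * M"
    using D.regular_estimator_information_bound[OF reg L2] nn(2)
    by (smt (verit) M_def mult_right_mono)
  then have "\<kappa> \<le> M" using nn by (cases "\<kappa> = 0") (simp_all add: power2_eq_square)
  then show ?thesis by (simp add: \<kappa>_def M_def)
qed

text \<open>The moment bounds are strict at each covariate, so a margin of 1 / (k + 1) fits from
  some k on that depends on x; only overlap restricts the claim to almost every x.\<close>

lemma AE_eventually_well_inside: "AE x in px S. \<forall>\<^sub>F k in sequentially. x \<in> well_inside k"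
proof -
  have "AE x in px S. \<forall>d. eps < gprop S d x \<and> gprop S d x \<le> 1 - eps"
    using model unfolding in_model_def by blast
  then show ?thesis
  proof (rule AE_mp, intro AE_I2 impI)
    fix x assume g: "\<forall>d. eps < gprop S d x \<and> gprop S d x \<le> 1 - eps"
    have lim: "(\<lambda>k. 1 / real (Suc k)) \<longlonglongrightarrow> 0"
      using LIMSEQ_inverse_real_of_nat by (simp add: inverse_eq_divide)
    have ev: "\<forall>\<^sub>F k in sequentially. \<bar>mu S d x\<bar> < Chi - 1 / Suc k \<and> Clo + 1 / Suc k < sig2 S d x
      \<and> sig2 S d x < Chi - 1 / Suc k" for d
    proof -
      define m where "m = min (Chi - \<bar>mu S d x\<bar>) (min (sig2 S d x - Clo) (Chi - sig2 S d x))"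
      have "0 < m" using mu_bound[of d x] sig2_bounds[of d x] by (simp add: m_def)
      from order_tendstoD(2)[OF lim this] show ?thesis
        by eventually_elim (simp add: m_def)
    qed
    show "\<forall>\<^sub>F k in sequentially. x \<in> well_inside k"
      using ev[of True] ev[of False]
    proof eventually_elim
      case (elim k)
      then show ?case using g unfolding well_inside_def by (auto simp: all_bool_eq)
    qed
  qed
qed

lemma bound_integrand_integral_tendsto: "(\<lambda>k. \<integral>x. bound_integrand k x \<partial>px S) \<longlonglongrightarrow> V_OS S"
  unfolding V_OS_eq
proof (rule integral_dominated_convergence[where w="\<lambda>_. (4 * Chi)\<^sup>2 + 2 * Chi / eps"])
  show "AE x in px S. (\<lambda>k. bound_integrand k x) \<longlonglongrightarrow>
      sig2 S True x / gprop S True x + sig2 S False x / gprop S False x + (centered_cate x)\<^sup>2"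
    using AE_eventually_well_inside
  proof (rule AE_mp, intro AE_I2 impI)
    fix x assume ev: "\<forall>\<^sub>F k in sequentially. x \<in> well_inside k"
    then obtain k where "x \<in> well_inside k" using eventually_happens'[OF sequentially_bot] by blast
    then have g: "gprop S d x \<noteq> 0" for d using gprop_well_inside[of x k d] eps_pos by simp
    have "(\<lambda>k. (centered_cate x)\<^sup>2 + (trunc_var k True x / gprop S True x + trunc_var k False x / gprop S False x))
      \<longlonglongrightarrow> (centered_cate x)\<^sup>2 + (sig2 S True x / gprop S True x + sig2 S False x / gprop S False x)"
      by (intro tendsto_intros trunc_var_tendsto g)
    then show "(\<lambda>k. bound_integrand k x) \<longlonglongrightarrow>
      sig2 S True x / gprop S True x + sig2 S False x / gprop S False x + (centered_cate x)\<^sup>2"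
      unfolding add.commute[of "(centered_cate x)\<^sup>2"]
      by (rule Lim_transform_eventually)
        (use ev in \<open>auto elim!: eventually_mono simp: bound_integrand_def\<close>)
  qed
  show "integrable (px S) (\<lambda>_. (4 * Chi)\<^sup>2 + 2 * Chi / eps)"
    by (rule integrable_px_bounded[of _ "\<bar>(4 * Chi)\<^sup>2 + 2 * Chi / eps\<bar>"]) auto
  show "AE x in px S. norm (bound_integrand k x) \<le> (4 * Chi)\<^sup>2 + 2 * Chi / eps" for k
    using bound_integrand_nonneg bound_integrand_le by auto
qed measurable

end

theorem mainTheorem2:
  fixes Clo Chi eps :: real
    and S0 :: "'x::euclidean_space dgp"
    and T :: "nat \<Rightarrow> (nat \<Rightarrow> 'x obs) \<Rightarrow> real"
    and L :: "real measure"
  assumes "0 < Clo" and "Clo < Chi" and "0 < eps" and "eps < 1 / 2"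
    and "in_model Clo Chi eps S0"
    and "regular_estimator Clo Chi eps S0 T L"
  shows "ennreal (V_OS S0) \<le> (\<integral>\<^sup>+x. ennreal (x\<^sup>2) \<partial>L)
       \<and> V_OS S0 = (\<integral>x. sig2 S0 True x / gprop S0 True x + sig2 S0 False x / gprop S0 False x
                        + (cate S0 x - tau S0)\<^sup>2 \<partial>(px S0))"
proof -
  interpret dgp_kernel S0 by (rule in_model_dgp_kernel) fact
  interpret model_point S0 Clo Chi eps by unfold_locales fact+
  have L: "real_distribution L"
    using assms(6) unfolding regular_estimator_def by blast
  then interpret L: real_distribution L .
  have "ennreal (V_OS S0) \<le> (\<integral>\<^sup>+x. ennreal (x\<^sup>2) \<partial>L)"
  \<comment> \<open>An infinite second moment makes the bound trivial; otherwise L is square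
    integrable, as \<open>truncated_bound\<close> assumes.\<close>
  proof (cases "(\<integral>\<^sup>+x. ennreal (x\<^sup>2) \<partial>L) = \<infinity>")
    case False
    then have L2: "integrable L (\<lambda>x. x\<^sup>2)"
      by (intro integrableI_nonneg) (auto simp: less_top)
    have "V_OS S0 \<le> (\<integral>x. x\<^sup>2 \<partial>L)"
      by (rule LIMSEQ_le_const2[OF bound_integrand_integral_tendsto])
        (use truncated_bound[OF assms(6) L2] in auto)
    then have "ennreal (V_OS S0) \<le> ennreal (\<integral>x. x\<^sup>2 \<partial>L)" by (rule ennreal_leI)
    also have "\<dots> = (\<integral>\<^sup>+x. ennreal (x\<^sup>2) \<partial>L)"
      by (rule nn_integral_eq_integral[OF L2, symmetric]) simp
    finally show ?thesis .
  qed simp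
  then show ?thesis using V_OS_eq by (simp add: centered_cate_def)
qed

end
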